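(* Let $(A,B)$ be a pair of real random variables and $\alpha>0$, with $\mathbb{P}(A<0)>0$, $\mathbb{P}(A>0)>0$, $\mathbb{E}\log|A|<0$ and $\mathbb{E}|A|^{\alpha}=1$. Assume that for a slowly varying function $L$ and constants $p,q\ge 0$ with $p+q=1$, $$\mathbb{P}(B>t)\sim p\,t^{-\alpha}L(t),\qquad\mathbb{P}(B<-t)\sim q\,t^{-\alpha}L(t)\qquad(t\to\infty),$$ and that $\mathbb{E}|A|^{\alpha+\varepsilon}<\infty$ for some $\varepsilon>0$. Put $\mu_+=\mathbb{E}[A^{\alpha}\mathbf{1}_{\{A>0\}}]$. If $\mu_+<1$, then, as $t\to\infty$, $$\mathbb{P}(S>t)\sim\frac{1}{1-\mu_+}\mathbb{P}(B>t),\qquad\mathbb{P}(S<-t)\sim\frac{1}{1-\mu_+}\mathbb{P}(B<-t),$$ and $$\mathbb{P}(R_N^{*}>t)\sim\mathbb{P}(|B|>t)\sim\mathbb{P}(R_N^{*}<-t).$$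
   Context: $f(t)\sim g(t)$ means $\lim_{t\to\infty}f(t)/g(t)=1$; $f\sim c\,g$ with $c=0$ means $f(t)/g(t)\to0$. If $p=0$ (resp. $q=0$) the relation for $\mathbb{P}(S>t)$ (resp. $\mathbb{P}(S<-t)$) is understood as $\mathbb{P}(S>t)=o(t^{-\alpha}L(t))$ (resp. $\mathbb{P}(S<-t)=o(t^{-\alpha}L(t))$). A measurable $L:(0,\infty)\to(0,\infty)$ is slowly varying if $L(\lambda x)/L(x)\to1$ as $x\to\infty$ for every $\lambda>0$. $A_+=A\mathbf{1}_{\{A\ge0\}}$, $A_-=-A\mathbf{1}_{\{A<0\}}$. $S$ is the unique (in law) solution of $S\stackrel{d}{=}A_+S+B$ with $S$ and $(A_+,B)$ independent. $(A_n,B_n)_{n\ge1}$ are i.i.d. copies of $(A,B)$, $\Pi_n=A_1\cdots A_n$, $N=\inf\{n\ge1:\Pi_n\ge0\}$ (a.s. finite), $R_n^{*}=B_1+A_1B_2+\dots+A_1\cdots A_{n-1}B_n$, and $R_N^{*}$ is its value at $n=N$. *)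

theory Defs
  imports "HOL-Probability.Probability"
begin

definition trunc_pos :: "real \<Rightarrow> real" where
  "trunc_pos a = a * indicator {0..} a"

text \<open>
  The library's \<open>indep_var\<close> requires both variables to take values in the same
  type; this is the same notion for two different value types.
\<close>
definition indep_pair ::
    "'a measure \<Rightarrow> 'b measure \<Rightarrow> ('a \<Rightarrow> 'b) \<Rightarrow> 'c measure \<Rightarrow> ('a \<Rightarrow> 'c) \<Rightarrow> bool" where
  "indep_pair M N X N' Y \<longleftrightarrow>
     X \<in> measurable M N \<and> Y \<in> measurable M N' \<and>
     prob_space.indep_set M {X -` U \<inter> space M | U. U \<in> sets N}
                            {Y -` V \<inter> space M | V. V \<in> sets N'}"

definition slowly_varying :: "(real \<Rightarrow> real) \<Rightarrow> bool" where
  "slowly_varying L \<longleftrightarrow>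
     set_borel_measurable borel {0<..} L \<and>
     (\<forall>x>0. L x > 0) \<and>
     (\<forall>c>0. ((\<lambda>x. L (c * x) / L x) \<longlongrightarrow> 1) at_top)"

text \<open>
  \<open>f \<sim> c g\<close> as \<open>t \<rightarrow> \<infinity>\<close>, where the case \<open>c = 0\<close> means \<open>f / g \<rightarrow> 0\<close>.
  It is applied with \<open>g\<close> positive on \<open>(0, \<infinity>)\<close>.
\<close>
definition asymp_mult :: "(real \<Rightarrow> real) \<Rightarrow> real \<Rightarrow> (real \<Rightarrow> real) \<Rightarrow> bool" where
  "asymp_mult f c g \<longleftrightarrow> (if c = 0 then f \<in> o(g) else f \<sim>[at_top] (\<lambda>t. c * g t))"

text \<open>
  \<open>P(A = 0) > 0\<close> is allowed, and then \<open>E log |A| = - \<infinity>\<close>. As \<open>ln 0 = 0\<close> in the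
  library, the logarithm and its expectation have to be extended-real valued.
\<close>
definition log_abs :: "real \<Rightarrow> ereal" where
  "log_abs a = (if a = 0 then - \<infinity> else ereal (ln \<bar>a\<bar>))"

text \<open>
  \<open>E X = E X\<^sup>+ - E X\<^sup>-\<close>; \<open>e2ennreal\<close> maps negative arguments to \<open>0\<close>. Since
  \<open>\<infinity> - \<infinity> = \<infinity>\<close> in \<open>ereal\<close>, a value below \<open>\<infinity>\<close> implies \<open>E X\<^sup>+ < \<infinity>\<close>, so that the
  expectation is then well defined in \<open>[- \<infinity>, \<infinity>)\<close>.
\<close>
definition ext_expectation :: "'a measure \<Rightarrow> ('a \<Rightarrow> ereal) \<Rightarrow> ereal" where
  "ext_expectation M X =
     enn2ereal (\<integral>\<^sup>+ \<omega>. e2ennreal (X \<omega>) \<partial>M) - enn2ereal (\<integral>\<^sup>+ \<omega>. e2ennreal (- X \<omega>) \<partial>M)"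

text \<open>
  In the following definitions the sequences are indexed from 1; the entries at
  index 0 are not used.
\<close>
definition partial_product :: "(nat \<Rightarrow> 'a \<Rightarrow> real) \<Rightarrow> nat \<Rightarrow> 'a \<Rightarrow> real" where
  "partial_product As n \<omega> = (\<Prod>k=1..n. As k \<omega>)"

text \<open>
  The infimum of the empty set of naturals is \<open>0\<close> in the library; this concerns
  only the null set on which no partial product is nonnegative.
\<close>
definition first_nonneg :: "(nat \<Rightarrow> 'a \<Rightarrow> real) \<Rightarrow> 'a \<Rightarrow> nat" where
  "first_nonneg As \<omega> = Inf {n. n \<ge> 1 \<and> partial_product As n \<omega> \<ge> 0}"

definition perpetuity_sum ::
    "(nat \<Rightarrow> 'a \<Rightarrow> real) \<Rightarrow> (nat \<Rightarrow> 'a \<Rightarrow> real) \<Rightarrow> nat \<Rightarrow> 'a \<Rightarrow> real" where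
  "perpetuity_sum As Bs n \<omega> = (\<Sum>k=1..n. partial_product As (k - 1) \<omega> * Bs k \<omega>)"

definition stopped_perpetuity ::
    "(nat \<Rightarrow> 'a \<Rightarrow> real) \<Rightarrow> (nat \<Rightarrow> 'a \<Rightarrow> real) \<Rightarrow> 'a \<Rightarrow> real" where
  "stopped_perpetuity As Bs \<omega> = perpetuity_sum As Bs (first_nonneg As \<omega>) \<omega>"

end

theory Submission
  imports Defs
begin

text \<open>
  Write \<open>b t = P(\<bar>B\<bar> > t)\<close>. The tail of \<open>B\<close> enters only through \<open>b\<close>, which is regularly varying and
  monotone. Since \<open>E A\<^sub>+\<^sup>\<alpha> < 1\<close> and \<open>A\<close> has a moment of order above \<open>\<alpha>\<close>, the expectation of
  \<open>max ((\<theta> A\<^sub>+) powr (\<alpha> + \<epsilon>)) ((\<theta> A\<^sub>+) powr (\<alpha> - \<epsilon>))\<close> is below \<open>1\<close> for suitable \<open>\<theta> > 1\<close> and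
  \<open>\<epsilon> > 0\<close>, and a Potter majorant \<open>G\<close> of \<open>b\<close> turns this into a contraction, whence
  \<open>P(\<bar>S\<bar> > t) = O(b t)\<close>. A single-big-jump argument, in which a joint exceedance of \<open>A\<^sub>+ S\<close> and
  \<open>B\<close> is negligible, then shows that an asymptotic bound \<open>u\<close> for \<open>P(S > t) / b t\<close> improves to
  \<open>\<mu> u + p\<close>; iterating from above and from below gives the limit \<open>p / (1 - \<mu>)\<close>.

  For the stopped sum, \<open>R = B\<^sub>1 + min A\<^sub>1 0 * V\<close>, where \<open>V\<close> is the perpetuity driven by the positive
  parts of the later pairs. \<open>V\<close> is independent of \<open>(A\<^sub>1, B\<^sub>1)\<close> and its law solves the same fixed point
  equation, so one more big-jump step gives \<open>P(R > t) / b t \<longlongrightarrow> p + (1 - \<mu>) * (q / (1 - \<mu>)) = 1\<close>,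
  as \<open>E \<bar>A\<bar>\<^sup>\<alpha> = 1\<close>, and symmetrically for the left tail.
\<close>

section \<open>Potter bounds for monotone regularly varying tails\<close>

definition max_powr :: "real \<Rightarrow> real \<Rightarrow> real \<Rightarrow> real" where
  "max_powr \<alpha> \<epsilon> a = max (a powr (\<alpha> + \<epsilon>)) (a powr (\<alpha> - \<epsilon>))"

lemma max_powr_nonneg: "0 \<le> max_powr \<alpha> \<epsilon> a"
  by (simp add: max_powr_def le_max_iff_disj)

lemma max_powr_0 [simp]: "max_powr \<alpha> \<epsilon> 0 = 0"
  by (simp add: max_powr_def)

lemma max_powr_mult_le:
  assumes "0 \<le> x" "0 \<le> y"
  shows "max_powr \<alpha> \<epsilon> (x * y) \<le> max_powr \<alpha> \<epsilon> x * max_powr \<alpha> \<epsilon> y"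
  using assms by (auto simp: max_powr_def powr_mult le_max_iff_disj intro!: mult_mono)

lemma max_powr_measurable [measurable]: "max_powr \<alpha> \<epsilon> \<in> borel_measurable borel"
  unfolding max_powr_def by measurable

lemma max_powr_le:
  assumes "0 \<le> x" "0 < \<epsilon>" "\<epsilon> \<le> \<epsilon>'" "\<epsilon> \<le> \<alpha>"
  shows "max_powr \<alpha> \<epsilon> x \<le> 1 + x powr (\<alpha> + \<epsilon>')"
proof (cases "x \<le> 1")
  case True
  then have "x powr (\<alpha> + \<epsilon>) \<le> 1" "x powr (\<alpha> - \<epsilon>) \<le> 1" using assms by (auto intro: powr_le1)
  then show ?thesis by (simp add: max_powr_def) (smt (verit) powr_ge_zero)
next
  case False
  then have "x powr (\<alpha> + \<epsilon>) \<le> x powr (\<alpha> + \<epsilon>')" "x powr (\<alpha> - \<epsilon>) \<le> x powr (\<alpha> + \<epsilon>')"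
    using assms by (auto intro!: powr_mono)
  then show ?thesis by (simp add: max_powr_def)
qed

locale regular_tail =
  fixes b :: "real \<Rightarrow> real" and \<alpha> :: real
  assumes \<alpha>_pos: "\<alpha> > 0"
    and b_antimono: "s \<le> t \<Longrightarrow> b t \<le> b s"
    and b_pos: "b t > 0"
    and b_le_1: "b t \<le> 1"
    and b_scale: "c > 0 \<Longrightarrow> ((\<lambda>t. b (c * t) / b t) \<longlongrightarrow> c powr (- \<alpha>)) at_top"
begin

lemma b_doubling:
  assumes "\<epsilon> > 0"
  obtains x0 where "x0 > 0"
    and "\<And>t n. x0 \<le> t \<Longrightarrow> b (2 ^ n * t) \<le> 2 powr (- (\<alpha> - \<epsilon>) * n) * b t"
    and "\<And>t n. x0 \<le> t \<Longrightarrow> 2 powr (- (\<alpha> + \<epsilon>) * n) * b t \<le> b (2 ^ n * t)"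
proof -
  have "eventually (\<lambda>t. b (2 * t) / b t < 2 powr (- (\<alpha> - \<epsilon>))) at_top"
    using assms by (intro order_tendstoD(2)[OF b_scale]) auto
  moreover have "eventually (\<lambda>t. 2 powr (- (\<alpha> + \<epsilon>)) < b (2 * t) / b t) at_top"
    using assms by (intro order_tendstoD(1)[OF b_scale]) auto
  ultimately have "eventually (\<lambda>t. 1 \<le> t \<and> b (2 * t) \<le> 2 powr (- (\<alpha> - \<epsilon>)) * b t
      \<and> 2 powr (- (\<alpha> + \<epsilon>)) * b t \<le> b (2 * t)) at_top"
    using eventually_ge_at_top[of 1]
    by eventually_elim (use b_pos in \<open>auto simp: field_simps less_imp_le\<close>)
  then obtain x0 where x0: "\<And>t. x0 \<le> t \<Longrightarrow> 1 \<le> t \<and> b (2 * t) \<le> 2 powr (- (\<alpha> - \<epsilon>)) * b t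
      \<and> 2 powr (- (\<alpha> + \<epsilon>)) * b t \<le> b (2 * t)"
    by (auto simp: eventually_at_top_linorder)
  have ge: "x0 \<le> 2 ^ n * t" if "x0 \<le> t" for t and n :: nat
  proof -
    have "1 * t \<le> 2 ^ n * t" using x0[OF that] by (intro mult_right_mono) auto
    with that show ?thesis by simp
  qed
  have "b (2 ^ n * t) \<le> 2 powr (- (\<alpha> - \<epsilon>) * n) * b t \<and>
        2 powr (- (\<alpha> + \<epsilon>) * n) * b t \<le> b (2 ^ n * t)" if "x0 \<le> t" for t n
  proof (induction n)
    case (Suc n)
    have *: "2 powr (e * real (Suc n)) = 2 powr e * 2 powr (e * n)" for e :: real
      by (simp add: powr_add[symmetric] algebra_simps)
    have "b (2 * (2 ^ n * t)) \<le> 2 powr (- (\<alpha> - \<epsilon>)) * b (2 ^ n * t)"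
      using x0[OF ge[OF that, of n]] by blast
    also have "\<dots> \<le> 2 powr (- (\<alpha> - \<epsilon>)) * (2 powr (- (\<alpha> - \<epsilon>) * n) * b t)"
      using Suc by (intro mult_left_mono) auto
    finally have 1: "b (2 ^ Suc n * t) \<le> 2 powr (- (\<alpha> - \<epsilon>) * Suc n) * b t"
      unfolding * by (simp add: mult.assoc)
    have "2 powr (- (\<alpha> + \<epsilon>)) * (2 powr (- (\<alpha> + \<epsilon>) * n) * b t) \<le> 2 powr (- (\<alpha> + \<epsilon>)) * b (2 ^ n * t)"
      using Suc by (intro mult_left_mono) auto
    also have "\<dots> \<le> b (2 * (2 ^ n * t))"
      using x0[OF ge[OF that, of n]] by blast
    finally have "2 powr (- (\<alpha> + \<epsilon>) * Suc n) * b t \<le> b (2 ^ Suc n * t)"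
      unfolding * by (simp add: mult.assoc)
    with 1 show ?case by blast
  qed auto
  moreover have "x0 \<ge> 1" using x0 by blast
  ultimately show thesis by (intro that[of x0]) auto
qed

text \<open>Potter's bound; monotonicity of \<open>b\<close> replaces the uniform convergence theorem.\<close>
lemma b_potter:
  assumes \<epsilon>: "0 < \<epsilon>" "\<epsilon> < \<alpha>"
  obtains x0 C where "x0 > 0" "C > 0"
    "\<And>t y. x0 \<le> t \<Longrightarrow> 0 < y \<Longrightarrow> b y * min ((y / t) powr (\<alpha> + \<epsilon>)) ((y / t) powr (\<alpha> - \<epsilon>)) \<le> C * b t"
proof -
  obtain x0 where x0: "x0 > 0"
    and up: "\<And>t n. x0 \<le> t \<Longrightarrow> b (2 ^ n * t) \<le> 2 powr (- (\<alpha> - \<epsilon>) * n) * b t"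
    and lo: "\<And>t n. x0 \<le> t \<Longrightarrow> 2 powr (- (\<alpha> + \<epsilon>) * n) * b t \<le> b (2 ^ n * t)"
    using b_doubling[OF \<epsilon>(1)] by blast
  let ?v = "\<lambda>x::real. min (x powr (\<alpha> + \<epsilon>)) (x powr (\<alpha> - \<epsilon>))"
  have A: "b y * ?v (y / t) \<le> 2 powr (\<alpha> + \<epsilon>) * b t" if "x0 \<le> t" "t \<le> y" for t y
  proof -
    define z where "z = log 2 (y / t)"
    define n where "n = nat \<lfloor>z\<rfloor>"
    have z: "0 \<le> z" "y / t = 2 powr z" using that x0 by (auto simp: z_def zero_le_log_cancel_iff)
    have n: "n \<le> z" "z < n + 1" using z unfolding n_def by linarith+
    have "2 ^ n * t \<le> y"
    proof -
      have "2 ^ n = 2 powr (real n)" by (simp add: powr_realpow)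
      also have "\<dots> \<le> y / t" unfolding z(2) using n by simp
      finally show ?thesis using that x0 by (simp add: field_simps)
    qed
    then have "b y \<le> b (2 ^ n * t)" by (rule b_antimono)
    also have "\<dots> \<le> 2 powr (- (\<alpha> - \<epsilon>) * n) * b t" using up that by blast
    finally have "b y * ?v (y / t) \<le> (2 powr (- (\<alpha> - \<epsilon>) * n) * b t) * 2 powr (z * (\<alpha> - \<epsilon>))"
      unfolding z(2) using b_pos[of y] b_pos[of t] by (intro mult_mono) (auto simp: powr_powr intro: less_imp_le)
    also have "\<dots> = 2 powr ((\<alpha> - \<epsilon>) * (z - n)) * b t"
      by (simp add: powr_add[symmetric] algebra_simps)
    also have "\<dots> \<le> 2 powr (\<alpha> + \<epsilon>) * b t"
    proof (intro mult_right_mono powr_mono)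
      have "(\<alpha> - \<epsilon>) * (z - n) \<le> (\<alpha> - \<epsilon>) * 1" using \<epsilon> n by (intro mult_left_mono) auto
      also have "\<dots> \<le> \<alpha> + \<epsilon>" using \<epsilon> by simp
      finally show "(\<alpha> - \<epsilon>) * (z - n) \<le> \<alpha> + \<epsilon>" .
    qed (use b_pos in \<open>auto simp: less_imp_le\<close>)
    finally show ?thesis .
  qed
  have B: "b y * ?v (y / t) \<le> 2 powr (\<alpha> + \<epsilon>) * b t" if "x0 \<le> y" "y \<le> t" for t y
  proof -
    define z where "z = log 2 (t / y)"
    define n where "n = nat \<lfloor>z\<rfloor>"
    have "0 \<le> z" "t / y = 2 powr z" using that x0 by (auto simp: z_def zero_le_log_cancel_iff)
    then have z: "0 \<le> z" "t / y = 2 powr z" "y / t = 2 powr (- z)"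
      by (auto simp: powr_minus) (metis inverse_divide)
    have n: "n \<le> z" "z < n + 1" using z unfolding n_def by linarith+
    have "t \<le> 2 ^ Suc n * y"
    proof -
      have "t / y \<le> 2 powr (real (Suc n))" unfolding z(2) using n by simp
      also have "\<dots> = 2 ^ Suc n" using powr_realpow[of 2 "Suc n"] by simp
      finally show ?thesis using that x0 by (simp add: field_simps)
    qed
    then have "b (2 ^ Suc n * y) \<le> b t" by (rule b_antimono)
    moreover have "2 powr (- (\<alpha> + \<epsilon>) * Suc n) * b y \<le> b (2 ^ Suc n * y)" using lo that by blast
    ultimately have "2 powr ((\<alpha> + \<epsilon>) * Suc n) * (2 powr (- (\<alpha> + \<epsilon>) * Suc n) * b y)
        \<le> 2 powr ((\<alpha> + \<epsilon>) * Suc n) * b t"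
      by (intro mult_left_mono) auto
    then have *: "b y \<le> 2 powr ((\<alpha> + \<epsilon>) * Suc n) * b t"
      by (simp add: mult.assoc[symmetric] powr_add[symmetric] distrib_right[symmetric])
    have "b y * ?v (y / t) \<le> (2 powr ((\<alpha> + \<epsilon>) * Suc n) * b t) * 2 powr (- z * (\<alpha> + \<epsilon>))"
      unfolding z(3) using b_pos[of y] b_pos[of t] * by (intro mult_mono) (auto simp: powr_powr intro: less_imp_le)
    also have "\<dots> = 2 powr ((\<alpha> + \<epsilon>) * (Suc n - z)) * b t"
      by (simp add: powr_add[symmetric] algebra_simps)
    also have "\<dots> \<le> 2 powr (\<alpha> + \<epsilon>) * b t"
    proof (intro mult_right_mono powr_mono)
      have "(\<alpha> + \<epsilon>) * (Suc n - z) \<le> (\<alpha> + \<epsilon>) * 1" using \<epsilon> n by (intro mult_left_mono) auto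
      then show "(\<alpha> + \<epsilon>) * (Suc n - z) \<le> \<alpha> + \<epsilon>" by simp
    qed (use b_pos in \<open>auto simp: less_imp_le\<close>)
    finally show ?thesis .
  qed
  let ?C = "2 powr (\<alpha> + \<epsilon>) / b x0"
  have C: "2 powr (\<alpha> + \<epsilon>) * b t \<le> ?C * b t" for t
  proof (rule mult_right_mono)
    show "2 powr (\<alpha> + \<epsilon>) \<le> ?C" using b_pos[of x0] b_le_1[of x0] by (simp add: pos_le_divide_eq mult_left_le)
  qed (use b_pos[of t] in auto)
  have "b y * ?v (y / t) \<le> ?C * b t" if t: "x0 \<le> t" and y: "0 < y" for t y
  proof -
    consider "t \<le> y" | "x0 \<le> y" "y \<le> t" | "y < x0" by linarith
    then show ?thesis
    proof cases
      case 3
      have "y / t \<le> x0 / t" using 3 t x0 by (auto intro: divide_right_mono)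
      then have "?v (y / t) \<le> ?v (x0 / t)"
        using t x0 y \<epsilon> by (intro min.mono powr_mono2) auto
      then have "b y * ?v (y / t) \<le> 1 * ?v (x0 / t)"
        using b_le_1[of y] b_pos[of y] by (intro mult_mono) auto
      also have "\<dots> \<le> ?C * b t"
      proof -
        have "?v (x0 / t) \<le> (2 powr (\<alpha> + \<epsilon>) * b t) / b x0"
          using B[of x0 t] t b_pos[of x0] by (simp add: pos_le_divide_eq mult.commute)
        then show ?thesis by simp
      qed
      finally show ?thesis .
    next
      case 1
      then show ?thesis using A[OF t] C order.trans by blast
    next
      case 2
      then show ?thesis using B C order.trans by blast
    qed
  qed
  then show thesis using that[of x0 ?C] x0 b_pos by simp
qed

lemma scaling_majorant:
  assumes \<epsilon>: "0 < \<epsilon>" "\<epsilon> < \<alpha>"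
  obtains G C x0 where "x0 > 0" "C > 0"
    "\<And>t. t > 0 \<Longrightarrow> b t \<le> G t"
    "\<And>t a. t > 0 \<Longrightarrow> a > 0 \<Longrightarrow> G (t / a) \<le> max_powr \<alpha> \<epsilon> a * G t"
    "\<And>t. x0 \<le> t \<Longrightarrow> G t \<le> C * b t"
proof -
  let ?v = "\<lambda>x::real. min (x powr (\<alpha> + \<epsilon>)) (x powr (\<alpha> - \<epsilon>))"
  obtain x0 C where x0: "x0 > 0" "C > 0"
    and pot: "\<And>t y. x0 \<le> t \<Longrightarrow> 0 < y \<Longrightarrow> b y * ?v (y / t) \<le> C * b t"
    using b_potter[OF \<epsilon>] by blast
  define G where "G t = (SUP y\<in>{0<..}. b y * ?v (y / t))" for t
  have sub: "?v (x * a) \<le> ?v x * max_powr \<alpha> \<epsilon> a" if "x > 0" "a > 0" for x a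
  proof (cases "x powr (\<alpha> + \<epsilon>) \<le> x powr (\<alpha> - \<epsilon>)")
    case True
    have "?v (x * a) \<le> x powr (\<alpha> + \<epsilon>) * a powr (\<alpha> + \<epsilon>)" using that by (simp add: powr_mult)
    also have "\<dots> \<le> ?v x * max_powr \<alpha> \<epsilon> a" using True by (intro mult_mono) (auto simp: max_powr_def)
    finally show ?thesis .
  next
    case False
    have "?v (x * a) \<le> x powr (\<alpha> - \<epsilon>) * a powr (\<alpha> - \<epsilon>)" using that by (simp add: powr_mult)
    also have "\<dots> \<le> ?v x * max_powr \<alpha> \<epsilon> a" using False by (intro mult_mono) (auto simp: max_powr_def)
    finally show ?thesis .
  qed
  have scale: "b y * ?v (y / (t / a)) \<le> max_powr \<alpha> \<epsilon> a * (b y * ?v (y / t))"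
    if "t > 0" "a > 0" "y > 0" for t a y
    using mult_left_mono[OF sub[of "y / t" a], of "b y"] that b_pos[of y] by (simp add: mult_ac)
  have bdd: "bdd_above ((\<lambda>y. b y * ?v (y / t)) ` {0<..})" if "t > 0" for t
  proof (intro bdd_aboveI2)
    fix y :: real assume y: "y \<in> {0<..}"
    have "b y * ?v (y / t) \<le> max_powr \<alpha> \<epsilon> (x0 / t) * (b y * ?v (y / x0))"
      using scale[of x0 "x0 / t" y] that x0 y by simp
    also have "\<dots> \<le> max_powr \<alpha> \<epsilon> (x0 / t) * (C * b x0)"
      using pot[of x0 y] y by (intro mult_left_mono) (auto simp: max_powr_nonneg)
    finally show "b y * ?v (y / t) \<le> max_powr \<alpha> \<epsilon> (x0 / t) * (C * b x0)" .
  qed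
  have upper: "b y * ?v (y / t) \<le> G t" if "t > 0" "y > 0" for t y
    unfolding G_def using that by (intro cSUP_upper bdd) auto
  show thesis
  proof (rule that[of x0 C G])
    show "b t \<le> G t" if "t > 0" for t using upper[of t t] that by simp
    show "G (t / a) \<le> max_powr \<alpha> \<epsilon> a * G t" if "t > 0" "a > 0" for t a
      unfolding G_def[of "t / a"]
    proof (intro cSUP_least)
      fix y :: real assume y: "y \<in> {0<..}"
      have "b y * ?v (y / (t / a)) \<le> max_powr \<alpha> \<epsilon> a * (b y * ?v (y / t))" using scale that y by simp
      also have "\<dots> \<le> max_powr \<alpha> \<epsilon> a * G t" using upper that y by (intro mult_left_mono) (auto simp: max_powr_nonneg)
      finally show "b y * ?v (y / (t / a)) \<le> max_powr \<alpha> \<epsilon> a * G t" .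
    qed auto
    show "G t \<le> C * b t" if "x0 \<le> t" for t
      unfolding G_def using pot that by (intro cSUP_least) auto
  qed (use x0 in auto)
qed

end

section \<open>Tail bound for the fixed point\<close>

lemma affine_invariant_set_below:
  fixes D :: "real set"
  assumes "D \<noteq> {}" "bdd_below D" and m: "0 \<le> m" "m < 1"
    and inv: "\<And>u \<delta>. u \<in> D \<Longrightarrow> \<delta> > 0 \<Longrightarrow> m * u + c + \<delta> \<in> D"
    and v: "c / (1 - m) < v"
  shows "\<exists>u\<in>D. u < v"
proof (rule ccontr)
  assume "\<not> ?thesis"
  then have ge: "v \<le> u" if "u \<in> D" for u using that by force
  have "v \<le> Inf D" using ge assms(1) by (intro cInf_greatest) auto
  then have gap: "c + m * Inf D < Inf D"
  proof -
    have "c / (1 - m) < Inf D" using v \<open>v \<le> Inf D\<close> by linarith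
    then show ?thesis using m by (simp add: field_simps)
  qed
  define \<delta> where "\<delta> = (Inf D - (c + m * Inf D)) / 3"
  have \<delta>: "\<delta> > 0" using gap by (simp add: \<delta>_def)
  obtain u where u: "u \<in> D" "u < Inf D + \<delta>"
    using cInf_lessD[OF assms(1), of "Inf D + \<delta>"] \<delta> by auto
  have "Inf D \<le> m * u + c + \<delta>" using inv[OF u(1) \<delta>] assms(2) by (intro cInf_lower)
  moreover have "m * u \<le> m * Inf D + \<delta>"
  proof -
    have "m * u \<le> m * (Inf D + \<delta>)" using u(2) m by (intro mult_left_mono) auto
    moreover have "m * \<delta> \<le> \<delta>" using m \<delta> by (simp add: mult_left_le_one_le)
    ultimately show ?thesis by (simp add: distrib_left)
  qed
  ultimately show False using gap \<delta> by (simp add: \<delta>_def field_simps)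
qed

lemma (in pair_prob_space) prob_pair_eq_integral:
  assumes [measurable]: "Measurable.pred (M1 \<Otimes>\<^sub>M M2) Q"
  shows "\<P>(z in M1 \<Otimes>\<^sub>M M2. Q z) = (\<integral>x. \<P>(y in M2. Q (x, y)) \<partial>M1)"
proof -
  have "emeasure (M1 \<Otimes>\<^sub>M M2) {z \<in> space (M1 \<Otimes>\<^sub>M M2). Q z} =
      (\<integral>\<^sup>+x. emeasure M2 (Pair x -` {z \<in> space (M1 \<Otimes>\<^sub>M M2). Q z}) \<partial>M1)"
    by (rule M2.emeasure_pair_measure_alt) measurable
  also have "\<dots> = (\<integral>\<^sup>+x. ennreal (\<P>(y in M2. Q (x, y))) \<partial>M1)"
    by (intro nn_integral_cong)
       (auto simp: M2.emeasure_eq_measure space_pair_measure intro!: arg_cong[where f = "measure M2"])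
  finally show ?thesis
    by (subst integral_eq_nn_integral) (auto simp: measure_def)
qed

lemma borel_measurable_antimono:
  fixes f :: "real \<Rightarrow> real"
  assumes "\<And>s t. s \<le> t \<Longrightarrow> f t \<le> f s"
  shows "f \<in> borel_measurable borel"
proof -
  have "(\<lambda>x. - f x) \<in> borel_measurable borel"
    using assms by (intro borel_measurable_mono) (auto simp: mono_def)
  then show ?thesis by simp
qed

lemma (in prob_space) prob_gt_antimono:
  fixes Y :: "'a \<Rightarrow> real"
  assumes [measurable]: "Y \<in> borel_measurable M" and "s \<le> t"
  shows "\<P>(\<omega> in M. Y \<omega> > t) \<le> \<P>(\<omega> in M. Y \<omega> > s)"
  using assms(2) by (intro finite_measure_mono) auto

lemma (in prob_space) prob_gt_tendsto_0:
  fixes Y :: "'a \<Rightarrow> real"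
  assumes [measurable]: "Y \<in> borel_measurable M"
  shows "((\<lambda>t. \<P>(\<omega> in M. Y \<omega> > t)) \<longlongrightarrow> 0) at_top"
proof -
  have "((\<lambda>t. \<integral>\<omega>. indicat_real {\<omega> \<in> space M. Y \<omega> > t} \<omega> \<partial>M) \<longlongrightarrow> (\<integral>\<omega>. 0 \<partial>M)) at_top"
  proof (rule integral_dominated_convergence_at_top[where w = "\<lambda>_. 1"])
    show "AE \<omega> in M. ((\<lambda>t. indicat_real {\<omega> \<in> space M. Y \<omega> > t} \<omega>) \<longlongrightarrow> 0) at_top"
    proof (intro AE_I2 tendsto_eventually)
      fix \<omega> show "eventually (\<lambda>t. indicat_real {\<omega> \<in> space M. Y \<omega> > t} \<omega> = 0) at_top"
        using eventually_ge_at_top[of "Y \<omega>"] by eventually_elim (auto simp: indicator_def)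
    qed
  qed (auto simp: indicator_def)
  then show ?thesis by (simp add: Collect_conj_eq)
qed

text \<open>
  One step \<open>s \<mapsto> X s + B\<close> of the recursion, with \<open>s\<close> distributed according to \<open>N\<close> independently
  of \<open>(X, B)\<close>; \<open>G\<close> is a majorant of the tail \<open>b\<close> of \<open>\<bar>B\<bar>\<close> as in \<open>scaling_majorant\<close>.
\<close>
locale affine_step = regular_tail b \<alpha> + pair_prob_space M N
  for b :: "real \<Rightarrow> real" and \<alpha> :: real and M :: "'a measure" and N :: "real measure" +
  fixes X B :: "'a \<Rightarrow> real" and G :: "real \<Rightarrow> real" and C x0 \<epsilon> :: real
  assumes sets_N [measurable_cong]: "sets N = sets borel"
    and X_meas [measurable]: "X \<in> borel_measurable M"
    and B_meas [measurable]: "B \<in> borel_measurable M"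
    and X_nonneg: "0 \<le> X \<omega>"
    and b_eq: "b t = \<P>(\<omega> in M. \<bar>B \<omega>\<bar> > t)"
    and x0: "0 < x0" and C: "0 < C" and \<epsilon>: "0 < \<epsilon>" "\<epsilon> < \<alpha>"
    and G_ge: "0 < t \<Longrightarrow> b t \<le> G t"
    and G_scale: "0 < t \<Longrightarrow> 0 < a \<Longrightarrow> G (t / a) \<le> max_powr \<alpha> \<epsilon> a * G t"
    and G_le: "x0 \<le> t \<Longrightarrow> G t \<le> C * b t"
begin

lemma space_N [simp]: "space N = UNIV"
  using sets_eq_imp_space_eq[OF sets_N] by simp

lemma G_pos: "0 < t \<Longrightarrow> 0 < G t"
  using G_ge[of t] b_pos[of t] by linarith

lemma b_meas [measurable]: "b \<in> borel_measurable borel"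
  using b_antimono by (rule borel_measurable_antimono)

lemma N_gt_meas:
  fixes f :: "real \<Rightarrow> real"
  assumes [measurable]: "f \<in> borel_measurable borel"
  shows "(\<lambda>t. \<P>(s in N. f s > t)) \<in> borel_measurable borel"
  by (intro borel_measurable_antimono M2.prob_gt_antimono) auto

lemmas N_gt_meas' [measurable] = N_gt_meas[of "\<lambda>s. s", simplified] N_gt_meas[of "\<lambda>s. \<bar>s\<bar>", simplified]

lemma prob_mult_gt:
  fixes f :: "real \<Rightarrow> real"
  assumes "0 < t" and [measurable]: "f \<in> borel_measurable borel"
  shows "\<P>(z in M \<Otimes>\<^sub>M N. X (fst z) * f (snd z) > t) =
      (\<integral>\<omega>. (if 0 < X \<omega> then \<P>(s in N. f s > t / X \<omega>) else 0) \<partial>M)"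
proof -
  have "\<P>(z in M \<Otimes>\<^sub>M N. X (fst z) * f (snd z) > t) = (\<integral>\<omega>. \<P>(s in N. X \<omega> * f s > t) \<partial>M)"
    by (subst prob_pair_eq_integral) auto
  also have "\<dots> = (\<integral>\<omega>. (if 0 < X \<omega> then \<P>(s in N. f s > t / X \<omega>) else 0) \<partial>M)"
  proof (intro Bochner_Integration.integral_cong refl)
    fix \<omega>
    show "\<P>(s in N. X \<omega> * f s > t) = (if 0 < X \<omega> then \<P>(s in N. f s > t / X \<omega>) else 0)"
    proof (cases "0 < X \<omega>")
      case True
      then show ?thesis by (simp add: pos_divide_less_eq mult.commute)
    next
      case False
      with X_nonneg[of \<omega>] assms(1) show ?thesis by (simp add: less_eq_real_def)
    qed
  qed
  finally show ?thesis .
qed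

lemma prob_fst:
  assumes [measurable]: "Measurable.pred M Q"
  shows "\<P>(z in M \<Otimes>\<^sub>M N. Q (fst z)) = \<P>(\<omega> in M. Q \<omega>)"
proof -
  have "\<P>(z in M \<Otimes>\<^sub>M N. Q (fst z)) = (\<integral>\<omega>. \<P>(s in N. Q \<omega>) \<partial>M)"
    by (subst prob_pair_eq_integral) auto
  also have "\<dots> = (\<integral>\<omega>. indicator {\<omega> \<in> space M. Q \<omega>} \<omega> \<partial>M)"
    by (intro Bochner_Integration.integral_cong) (use M2.prob_space in \<open>auto split: split_indicator\<close>)
  finally show ?thesis by (simp add: Collect_conj_eq)
qed

lemma integrable_if_bounded:
  fixes f :: "'a \<Rightarrow> real"
  assumes [measurable]: "f \<in> borel_measurable M" and "\<And>\<omega>. 0 \<le> f \<omega>" "\<And>\<omega>. f \<omega> \<le> 1"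
  shows "integrable M f"
  using assms by (intro M1.integrable_const_bound[where B = 1]) auto

lemma fixed_point_tail_bound:
  assumes fixed: "N = distr (M \<Otimes>\<^sub>M N) borel (\<lambda>z. X (fst z) * snd z + B (fst z))"
    and \<theta>: "1 < \<theta>" and int: "integrable M (\<lambda>\<omega>. max_powr \<alpha> \<epsilon> (\<theta> * X \<omega>))"
    and less1: "(\<integral>\<omega>. max_powr \<alpha> \<epsilon> (\<theta> * X \<omega>) \<partial>M) < 1"
  shows "\<exists>K. \<forall>t>0. \<P>(s in N. \<bar>s\<bar> > t) \<le> K * G t"
proof -
  define h where "h t = \<P>(s in N. \<bar>s\<bar> > t)" for t
  have h_meas [measurable]: "h \<in> borel_measurable borel" unfolding h_def by measurable
  have h01: "0 \<le> h t" "h t \<le> 1" for t unfolding h_def by auto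
  define \<rho> where "\<rho> = (\<integral>\<omega>. max_powr \<alpha> \<epsilon> (\<theta> * X \<omega>) \<partial>M)"
  have \<rho>: "0 \<le> \<rho>" "\<rho> < 1" using less1 by (auto simp: \<rho>_def max_powr_nonneg)
  define \<eta> where "\<eta> = 1 - 1 / \<theta>"
  have \<eta>: "0 < \<eta>" using \<theta> by (simp add: \<eta>_def)
  define c where "c = max_powr \<alpha> \<epsilon> (1 / \<eta>)"
  have step: "h t \<le> (\<integral>\<omega>. (if 0 < X \<omega> then h (t / (\<theta> * X \<omega>)) else 0) \<partial>M) + c * G t" if t: "0 < t" for t
  proof -
    have "h t = \<P>(s in distr (M \<Otimes>\<^sub>M N) borel (\<lambda>z. X (fst z) * snd z + B (fst z)). \<bar>s\<bar> > t)"
      unfolding h_def by (subst fixed) simp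
    also have "\<dots> = \<P>(z in M \<Otimes>\<^sub>M N. \<bar>X (fst z) * snd z + B (fst z)\<bar> > t)"
      by (subst measure_distr) (auto intro!: arg_cong[where f = "measure _"])
    also have "\<dots> \<le> measure (M \<Otimes>\<^sub>M N) ({z \<in> space (M \<Otimes>\<^sub>M N). X (fst z) * \<bar>snd z\<bar> > t / \<theta>} \<union>
        {z \<in> space (M \<Otimes>\<^sub>M N). \<bar>B (fst z)\<bar> > \<eta> * t})"
    proof (intro P.finite_measure_mono subsetI)
      fix z assume z: "z \<in> {z \<in> space (M \<Otimes>\<^sub>M N). \<bar>X (fst z) * snd z + B (fst z)\<bar> > t}"
      have "t / \<theta> + \<eta> * t = t" by (simp add: \<eta>_def field_simps)
      moreover have "\<bar>X (fst z) * snd z + B (fst z)\<bar> \<le> X (fst z) * \<bar>snd z\<bar> + \<bar>B (fst z)\<bar>"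
        using abs_triangle_ineq[of "X (fst z) * snd z" "B (fst z)"] X_nonneg[of "fst z"] by (simp add: abs_mult)
      ultimately show "z \<in> {z \<in> space (M \<Otimes>\<^sub>M N). X (fst z) * \<bar>snd z\<bar> > t / \<theta>} \<union>
        {z \<in> space (M \<Otimes>\<^sub>M N). \<bar>B (fst z)\<bar> > \<eta> * t}" using z by auto
    qed measurable
    also have "\<dots> \<le> \<P>(z in M \<Otimes>\<^sub>M N. X (fst z) * \<bar>snd z\<bar> > t / \<theta>) + \<P>(z in M \<Otimes>\<^sub>M N. \<bar>B (fst z)\<bar> > \<eta> * t)"
      by (intro measure_Un_le) measurable
    also have "\<P>(z in M \<Otimes>\<^sub>M N. X (fst z) * \<bar>snd z\<bar> > t / \<theta>) =
        (\<integral>\<omega>. (if 0 < X \<omega> then h (t / (\<theta> * X \<omega>)) else 0) \<partial>M)"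
      unfolding h_def using prob_mult_gt[of "t / \<theta>" "\<lambda>s. \<bar>s\<bar>"] t \<theta> by (simp cong: if_cong)
    also have "\<P>(z in M \<Otimes>\<^sub>M N. \<bar>B (fst z)\<bar> > \<eta> * t) = b (\<eta> * t)"
      unfolding b_eq by (rule prob_fst) measurable
    also have "b (\<eta> * t) \<le> c * G t"
      unfolding c_def using G_ge[of "\<eta> * t"] G_scale[of t "1 / \<eta>"] t \<eta> by (simp add: mult.commute)
    finally show ?thesis by simp
  qed
  have bound: "h t \<le> v * G t + \<delta>" if v: "c / (1 - \<rho>) < v" and \<delta>: "\<delta> > 0" and t: "t > 0" for v \<delta> t
  proof -
    define D where "D = {K. 0 \<le> K \<and> (\<forall>t>0. h t \<le> \<delta> + K * G t)}"
    obtain x where x: "x > 0" "\<And>t. x \<le> t \<Longrightarrow> h t \<le> \<delta>"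
    proof -
      have "eventually (\<lambda>t. h t < \<delta>) at_top"
        unfolding h_def using \<delta> by (intro order_tendstoD(2)[OF M2.prob_gt_tendsto_0]) auto
      then obtain y where y: "\<And>t. y \<le> t \<Longrightarrow> h t < \<delta>" by (auto simp: eventually_at_top_linorder)
      show thesis by (rule that[of "max y 1"]) (auto intro: less_imp_le[OF y])
    qed
    have "h t \<le> \<delta> + 1 / b x * G t" if t: "0 < t" for t
    proof (cases "x \<le> t")
      case True
      then show ?thesis using x(2)[of t] G_pos[OF t] b_pos[of x] by (simp add: add_increasing2)
    next
      case False
      then have "b x \<le> G t" using b_antimono[of t x] G_ge[OF t] by linarith
      then have "1 \<le> 1 / b x * G t" using b_pos[of x] by (simp add: field_simps)
      then show ?thesis using h01(2)[of t] \<delta> by linarith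
    qed
    then have "1 / b x \<in> D" using b_pos[of x] by (simp add: D_def)
    then have "D \<noteq> {}" by blast
    moreover have "bdd_below D" by (intro bdd_belowI[of _ 0]) (auto simp: D_def)
    moreover have "\<rho> * K + c + d \<in> D" if K: "K \<in> D" and d: "d > 0" for K d
    proof -
      have K0: "0 \<le> K" using K by (simp add: D_def)
      have "h t \<le> \<delta> + (\<rho> * K + c + d) * G t" if t: "0 < t" for t
      proof -
        have "(\<integral>\<omega>. (if 0 < X \<omega> then h (t / (\<theta> * X \<omega>)) else 0) \<partial>M) \<le>
            (\<integral>\<omega>. \<delta> + K * G t * max_powr \<alpha> \<epsilon> (\<theta> * X \<omega>) \<partial>M)"
        proof (intro integral_mono)
          show "integrable M (\<lambda>\<omega>. if 0 < X \<omega> then h (t / (\<theta> * X \<omega>)) else 0)"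
            using h01 by (intro integrable_if_bounded) auto
          show "integrable M (\<lambda>\<omega>. \<delta> + K * G t * max_powr \<alpha> \<epsilon> (\<theta> * X \<omega>))" using int by auto
          fix \<omega>
          show "(if 0 < X \<omega> then h (t / (\<theta> * X \<omega>)) else 0) \<le> \<delta> + K * G t * max_powr \<alpha> \<epsilon> (\<theta> * X \<omega>)"
          proof (cases "0 < X \<omega>")
            case True
            then have pos: "0 < \<theta> * X \<omega>" "0 < t / (\<theta> * X \<omega>)" using \<theta> t by auto
            have "h (t / (\<theta> * X \<omega>)) \<le> \<delta> + K * G (t / (\<theta> * X \<omega>))" using K pos unfolding D_def by blast
            also have "K * G (t / (\<theta> * X \<omega>)) \<le> K * (max_powr \<alpha> \<epsilon> (\<theta> * X \<omega>) * G t)"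
              using G_scale[OF t pos(1)] K0 by (rule mult_left_mono)
            finally show ?thesis using True by (simp add: mult_ac)
          qed (use X_nonneg[of \<omega>] \<delta> in \<open>simp add: less_eq_real_def\<close>)
        qed
        also have "\<dots> = \<delta> + \<rho> * K * G t"
          using int by (simp add: \<rho>_def M1.prob_space mult_ac)
        finally have "h t \<le> \<delta> + \<rho> * K * G t + c * G t" using step[OF t] by linarith
        moreover have "0 \<le> d * G t" using d G_pos[OF t] by simp
        ultimately show ?thesis by (simp add: distrib_right)
      qed
      moreover have "0 \<le> \<rho> * K + c + d" using K0 \<rho> d by (simp add: c_def max_powr_nonneg)
      ultimately show ?thesis by (simp add: D_def)
    qed
    ultimately obtain K where "K \<in> D" "K < v"
      using affine_invariant_set_below[OF _ _ \<rho> _ v, of D] by blast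
    then have "h t \<le> \<delta> + K * G t" "K * G t \<le> v * G t"
      using t G_pos[OF t] by (auto simp: D_def)
    then show ?thesis by linarith
  qed
  have "h t \<le> (c / (1 - \<rho>) + 1) * G t" if "t > 0" for t
    by (rule field_le_epsilon, rule bound) (use that in auto)
  then show ?thesis unfolding h_def by (intro exI[of _ "c / (1 - \<rho>) + 1"] allI impI)
qed

end

section \<open>The single big jump\<close>

locale affine_step_tail = affine_step +
  fixes K :: real
  assumes int_X: "integrable M (\<lambda>\<omega>. max_powr \<alpha> \<epsilon> (X \<omega>))"
    and N_tail_le: "0 < t \<Longrightarrow> \<P>(s in N. \<bar>s\<bar> > t) \<le> K * G t"
begin

lemma K_nonneg: "0 \<le> K"
proof -
  have "0 \<le> \<P>(s in N. \<bar>s\<bar> > 1)" by simp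
  also have "\<dots> \<le> K * G 1" by (rule N_tail_le) simp
  finally show ?thesis using G_pos[of 1] by (simp add: zero_le_mult_iff)
qed

lemma N_tail_scale_le:
  assumes "0 < t" "0 < a"
  shows "\<P>(s in N. \<bar>s\<bar> > t / a) \<le> K * G t * max_powr \<alpha> \<epsilon> a"
proof -
  have "\<P>(s in N. \<bar>s\<bar> > t / a) \<le> K * G (t / a)" using assms by (intro N_tail_le) auto
  also have "\<dots> \<le> K * (max_powr \<alpha> \<epsilon> a * G t)" using assms K_nonneg by (intro mult_left_mono G_scale)
  finally show ?thesis by (simp add: mult_ac)
qed

lemma truncated_mean_tendsto_0:
  fixes f :: "real \<Rightarrow> real"
  assumes "filterlim f at_top at_top"
  shows "((\<lambda>t. \<integral>\<omega>. (if f t < X \<omega> then max_powr \<alpha> \<epsilon> (X \<omega>) else 0) \<partial>M) \<longlongrightarrow> 0) at_top"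
proof -
  have "((\<lambda>t. \<integral>\<omega>. (if f t < X \<omega> then max_powr \<alpha> \<epsilon> (X \<omega>) else 0) \<partial>M) \<longlongrightarrow> (\<integral>\<omega>. 0 \<partial>M)) at_top"
  proof (rule integral_dominated_convergence_at_top[where w = "\<lambda>\<omega>. max_powr \<alpha> \<epsilon> (X \<omega>)"])
    show "AE \<omega> in M. ((\<lambda>t. if f t < X \<omega> then max_powr \<alpha> \<epsilon> (X \<omega>) else 0) \<longlongrightarrow> 0) at_top"
    proof (intro AE_I2 tendsto_eventually)
      fix \<omega>
      have "eventually (\<lambda>t. X \<omega> \<le> f t) at_top" using assms by (simp add: filterlim_at_top)
      then show "eventually (\<lambda>t. (if f t < X \<omega> then max_powr \<alpha> \<epsilon> (X \<omega>) else 0) = 0) at_top"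
        by eventually_elim auto
    qed
  qed (use int_X in \<open>auto simp: max_powr_nonneg\<close>)
  then show ?thesis by simp
qed

lemma joint_exceedance_negligible:
  assumes \<eta>: "0 < \<eta>"
  shows "((\<lambda>t. \<P>(z in M \<Otimes>\<^sub>M N. X (fst z) * \<bar>snd z\<bar> > \<eta> * t \<and> \<bar>B (fst z)\<bar> > \<eta> * t) / b t) \<longlongrightarrow> 0) at_top"
proof -
  define h where "h t = \<P>(s in N. \<bar>s\<bar> > t)" for t
  have h_meas [measurable]: "h \<in> borel_measurable borel" unfolding h_def by measurable
  define I where "I t = (\<integral>\<omega>. (if sqrt t < X \<omega> then max_powr \<alpha> \<epsilon> (X \<omega>) else 0) \<partial>M)" for t
  define c where "c = max_powr \<alpha> \<epsilon> (1 / \<eta>)"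
  let ?J = "\<lambda>t. \<P>(z in M \<Otimes>\<^sub>M N. X (fst z) * \<bar>snd z\<bar> > \<eta> * t \<and> \<bar>B (fst z)\<bar> > \<eta> * t)"
  have int_I: "integrable M (\<lambda>\<omega>. if sqrt t < X \<omega> then max_powr \<alpha> \<epsilon> (X \<omega>) else 0)" for t
    by (rule Bochner_Integration.integrable_bound[OF int_X]) (auto simp: max_powr_nonneg)
  have J_le: "?J t \<le> K * c * G t * I t + h (\<eta> * sqrt t) * b (\<eta> * t)" if t: "0 < t" for t
  proof -
    have "?J t = (\<integral>\<omega>. \<P>(s in N. X \<omega> * \<bar>s\<bar> > \<eta> * t \<and> \<bar>B \<omega>\<bar> > \<eta> * t) \<partial>M)"
      by (subst prob_pair_eq_integral) auto
    also have "\<dots> \<le> (\<integral>\<omega>. K * c * G t * (if sqrt t < X \<omega> then max_powr \<alpha> \<epsilon> (X \<omega>) else 0) +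
        h (\<eta> * sqrt t) * indicator {\<omega> \<in> space M. \<bar>B \<omega>\<bar> > \<eta> * t} \<omega> \<partial>M)"
    proof (intro integral_mono)
      show "integrable M (\<lambda>\<omega>. \<P>(s in N. X \<omega> * \<bar>s\<bar> > \<eta> * t \<and> \<bar>B \<omega>\<bar> > \<eta> * t))"
        by (intro integrable_if_bounded) auto
      show "integrable M (\<lambda>\<omega>. K * c * G t * (if sqrt t < X \<omega> then max_powr \<alpha> \<epsilon> (X \<omega>) else 0) +
        h (\<eta> * sqrt t) * indicator {\<omega> \<in> space M. \<bar>B \<omega>\<bar> > \<eta> * t} \<omega>)"
        using int_I by (intro Bochner_Integration.integrable_add integrable_mult_right) (auto intro!: integrable_if_bounded)
      fix \<omega> assume \<omega>: "\<omega> \<in> space M"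
      let ?q = "\<P>(s in N. X \<omega> * \<bar>s\<bar> > \<eta> * t \<and> \<bar>B \<omega>\<bar> > \<eta> * t)"
      have h0: "0 \<le> h x" for x by (simp add: h_def)
      show "?q \<le> K * c * G t * (if sqrt t < X \<omega> then max_powr \<alpha> \<epsilon> (X \<omega>) else 0) +
        h (\<eta> * sqrt t) * indicator {\<omega> \<in> space M. \<bar>B \<omega>\<bar> > \<eta> * t} \<omega>"
      proof (cases "sqrt t < X \<omega>")
        case True
        then have pos: "0 < X \<omega>" using t real_sqrt_gt_zero[OF t] by linarith
        have "?q \<le> h (t / (X \<omega> * (1 / \<eta>)))"
          unfolding h_def using pos \<eta> by (intro M2.finite_measure_mono) (auto simp: field_simps)
        also have "\<dots> \<le> K * G t * max_powr \<alpha> \<epsilon> (X \<omega> * (1 / \<eta>))"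
          unfolding h_def using pos \<eta> t by (intro N_tail_scale_le) auto
        also have "\<dots> \<le> K * G t * (max_powr \<alpha> \<epsilon> (X \<omega>) * c)"
          unfolding c_def using pos \<eta> K_nonneg G_pos[OF t] by (intro mult_left_mono max_powr_mult_le) auto
        finally show ?thesis using True h0[of "\<eta> * sqrt t"] by (auto simp: mult_ac intro: add_increasing2)
      next
        case False
        show ?thesis
        proof (cases "\<bar>B \<omega>\<bar> > \<eta> * t")
          case B: True
          have "?q \<le> h (\<eta> * sqrt t)"
            unfolding h_def
          proof (intro M2.finite_measure_mono subsetI)
            fix s assume "s \<in> {s \<in> space N. X \<omega> * \<bar>s\<bar> > \<eta> * t \<and> \<bar>B \<omega>\<bar> > \<eta> * t}"
            moreover have "X \<omega> * \<bar>s\<bar> \<le> sqrt t * \<bar>s\<bar>" using False by (intro mult_right_mono) auto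
            moreover have "\<eta> * t = sqrt t * (\<eta> * sqrt t)" using t by simp
            ultimately have "sqrt t * (\<eta> * sqrt t) < sqrt t * \<bar>s\<bar>" by auto
            then show "s \<in> {s \<in> space N. \<bar>s\<bar> > \<eta> * sqrt t}" using t by simp
          qed measurable
          then show ?thesis using False B \<omega> by simp
        qed (use False in simp)
      qed
    qed
    also have "\<dots> = K * c * G t * I t + h (\<eta> * sqrt t) * b (\<eta> * t)"
    proof -
      have "(\<integral>\<omega>. indicat_real {\<omega> \<in> space M. \<bar>B \<omega>\<bar> > \<eta> * t} \<omega> \<partial>M) = b (\<eta> * t)"
        unfolding b_eq by (simp add: Collect_conj_eq)
      then show ?thesis
        unfolding I_def
        by (subst Bochner_Integration.integral_add)
           (use int_I in \<open>auto intro!: integrable_if_bounded integrable_mult_right\<close>)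
    qed
    finally show ?thesis .
  qed
  show ?thesis
  proof (rule tendsto_sandwich)
    show "eventually (\<lambda>t. 0 \<le> ?J t / b t) at_top"
      by (intro always_eventually allI divide_nonneg_pos b_pos measure_nonneg)
    show "eventually (\<lambda>t. ?J t / b t \<le> K * c * C * I t + h (\<eta> * sqrt t) * (b (\<eta> * t) / b t)) at_top"
      using eventually_ge_at_top[of x0]
    proof eventually_elim
      case (elim t)
      then have t: "0 < t" using x0 by simp
      have "0 \<le> I t" unfolding I_def by (intro integral_nonneg_AE AE_I2) (auto simp: max_powr_nonneg)
      then have "0 \<le> K * c * I t" using K_nonneg by (simp add: c_def max_powr_nonneg)
      then have "K * c * I t * G t \<le> K * c * I t * (C * b t)" using G_le[OF elim] by (rule mult_left_mono[rotated])
      then have "?J t \<le> (K * c * C * I t) * b t + h (\<eta> * sqrt t) * b (\<eta> * t)"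
        using J_le[OF t] by (simp add: mult_ac)
      then show ?case using b_pos[of t] by (simp add: field_simps)
    qed
    have "filterlim (\<lambda>t. \<eta> * sqrt t) at_top at_top"
      by (rule filterlim_tendsto_pos_mult_at_top[OF tendsto_const \<eta> sqrt_at_top])
    moreover have "(h \<longlongrightarrow> 0) at_top"
      unfolding h_def by (rule M2.prob_gt_tendsto_0) measurable
    ultimately have "((\<lambda>t. h (\<eta> * sqrt t)) \<longlongrightarrow> 0) at_top"
      by (rule filterlim_compose[rotated])
    then have "((\<lambda>t. K * c * C * I t + h (\<eta> * sqrt t) * (b (\<eta> * t) / b t)) \<longlongrightarrow> K * c * C * 0 + 0 * \<eta> powr (- \<alpha>)) at_top"
      unfolding I_def using \<eta>
      by (intro tendsto_add tendsto_mult tendsto_const b_scale truncated_mean_tendsto_0 sqrt_at_top)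
    then show "((\<lambda>t. K * c * C * I t + h (\<eta> * sqrt t) * (b (\<eta> * t) / b t)) \<longlongrightarrow> 0) at_top" by simp
  qed auto
qed

definition X_moment :: real where "X_moment = (\<integral>\<omega>. X \<omega> powr \<alpha> \<partial>M)"

definition scaled_tail :: "real \<Rightarrow> real \<Rightarrow> 'a \<Rightarrow> real" where
  "scaled_tail T t \<omega> = (if 0 < X \<omega> \<and> T \<le> t / X \<omega> then b (t / X \<omega>) / b t else 0)"

lemma scaled_tail_meas [measurable]: "scaled_tail T t \<in> borel_measurable M"
  unfolding scaled_tail_def[abs_def] by measurable

lemma scaled_tail_bounds:
  assumes "x0 \<le> t"
  shows "0 \<le> scaled_tail T t \<omega>" "scaled_tail T t \<omega> \<le> C * max_powr \<alpha> \<epsilon> (X \<omega>)"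
proof -
  have t: "0 < t" using x0 assms by simp
  show "0 \<le> scaled_tail T t \<omega>"
    unfolding scaled_tail_def using b_pos by (auto intro!: divide_nonneg_pos less_imp_le)
  have "b (t / a) / b t \<le> C * max_powr \<alpha> \<epsilon> a" if a: "0 < a" for a
  proof -
    have "b (t / a) \<le> G (t / a)" using a t by (intro G_ge) auto
    also have "\<dots> \<le> max_powr \<alpha> \<epsilon> a * G t" using a t by (intro G_scale)
    also have "\<dots> \<le> max_powr \<alpha> \<epsilon> a * (C * b t)" using assms by (intro mult_left_mono G_le max_powr_nonneg)
    finally show ?thesis using b_pos[of t] by (simp add: field_simps)
  qed
  then show "scaled_tail T t \<omega> \<le> C * max_powr \<alpha> \<epsilon> (X \<omega>)"
    unfolding scaled_tail_def using C by (auto simp: max_powr_nonneg)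
qed

lemma scaled_tail_integrable:
  assumes "x0 \<le> t"
  shows "integrable M (scaled_tail T t)"
  using scaled_tail_bounds[OF assms]
  by (intro Bochner_Integration.integrable_bound[OF integrable_mult_right[OF int_X, of C]])
     (auto intro!: AE_I2 intro: order.trans[OF _ abs_ge_self])

lemma scaled_tail_mean_tendsto:
  "((\<lambda>t. \<integral>\<omega>. scaled_tail T t \<omega> \<partial>M) \<longlongrightarrow> X_moment) at_top"
  unfolding X_moment_def
proof (rule integral_dominated_convergence_at_top[where w = "\<lambda>\<omega>. C * max_powr \<alpha> \<epsilon> (X \<omega>)"])
  show "AE \<omega> in M. ((\<lambda>t. scaled_tail T t \<omega>) \<longlongrightarrow> X \<omega> powr \<alpha>) at_top"
  proof (intro AE_I2)
    fix \<omega>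
    show "((\<lambda>t. scaled_tail T t \<omega>) \<longlongrightarrow> X \<omega> powr \<alpha>) at_top"
    proof (cases "0 < X \<omega>")
      case True
      have "((\<lambda>t. b (1 / X \<omega> * t) / b t) \<longlongrightarrow> (1 / X \<omega>) powr (- \<alpha>)) at_top"
        using True by (intro b_scale) auto
      moreover have "(1 / X \<omega>) powr (- \<alpha>) = X \<omega> powr \<alpha>"
        using True by (simp add: powr_divide powr_minus field_simps)
      moreover have "eventually (\<lambda>t. b (1 / X \<omega> * t) / b t = scaled_tail T t \<omega>) at_top"
        using eventually_ge_at_top[of "T * X \<omega>"]
        by eventually_elim (use True in \<open>auto simp: scaled_tail_def field_simps\<close>)
      ultimately show ?thesis by (auto intro: Lim_transform_eventually)
    next
      case False
      then have "X \<omega> = 0" using X_nonneg[of \<omega>] by simp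
      then show ?thesis by (simp add: scaled_tail_def)
    qed
  qed
  show "\<forall>\<^sub>F t in at_top. AE \<omega> in M. norm (scaled_tail T t \<omega>) \<le> C * max_powr \<alpha> \<epsilon> (X \<omega>)"
    using eventually_ge_at_top[of x0] by eventually_elim (use scaled_tail_bounds in auto)
qed (use int_X in auto)

lemma mult_tail_upper:
  assumes "eventually (\<lambda>t. \<P>(s in N. s > t) \<le> u * b t) at_top" and "\<delta> > 0"
  shows "eventually (\<lambda>t. \<P>(z in M \<Otimes>\<^sub>M N. X (fst z) * snd z > t) \<le> (X_moment * u + \<delta>) * b t) at_top"
proof -
  define F where "F t = \<P>(s in N. s > t)" for t
  have F_meas [measurable]: "F \<in> borel_measurable borel" unfolding F_def by measurable
  obtain T where T: "0 < T" "\<And>t. T \<le> t \<Longrightarrow> F t \<le> u * b t"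
  proof -
    obtain T where "\<And>t. T \<le> t \<Longrightarrow> F t \<le> u * b t"
      using assms(1) by (auto simp: F_def eventually_at_top_linorder)
    then show thesis using that[of "max T 1"] by simp
  qed
  define I where "I t = (\<integral>\<omega>. (if t / T < X \<omega> then max_powr \<alpha> \<epsilon> (X \<omega>) else 0) \<partial>M)" for t
  have int_I: "integrable M (\<lambda>\<omega>. if t / T < X \<omega> then max_powr \<alpha> \<epsilon> (X \<omega>) else 0)" for t
    by (rule Bochner_Integration.integrable_bound[OF int_X]) (auto simp: max_powr_nonneg)
  have le: "\<P>(z in M \<Otimes>\<^sub>M N. X (fst z) * snd z > t) \<le>
      ((\<integral>\<omega>. scaled_tail T t \<omega> \<partial>M) * u + K * C * I t) * b t" if "x0 \<le> t" for t
  proof -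
    have t: "0 < t" using that x0 by simp
    have "\<P>(z in M \<Otimes>\<^sub>M N. X (fst z) * snd z > t) = (\<integral>\<omega>. (if 0 < X \<omega> then F (t / X \<omega>) else 0) \<partial>M)"
      unfolding F_def using t by (intro prob_mult_gt) auto
    also have "\<dots> \<le> (\<integral>\<omega>. u * b t * scaled_tail T t \<omega> +
        K * G t * (if t / T < X \<omega> then max_powr \<alpha> \<epsilon> (X \<omega>) else 0) \<partial>M)"
    proof (intro integral_mono)
      show "integrable M (\<lambda>\<omega>. if 0 < X \<omega> then F (t / X \<omega>) else 0)"
        by (intro integrable_if_bounded) (auto simp: F_def)
      show "integrable M (\<lambda>\<omega>. u * b t * scaled_tail T t \<omega> +
        K * G t * (if t / T < X \<omega> then max_powr \<alpha> \<epsilon> (X \<omega>) else 0))"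
        by (intro Bochner_Integration.integrable_add integrable_mult_right int_I scaled_tail_integrable that)
      fix \<omega>
      have nn: "0 \<le> K * G t * (if t / T < X \<omega> then max_powr \<alpha> \<epsilon> (X \<omega>) else 0)"
        using K_nonneg G_pos[OF t] by (auto simp: max_powr_nonneg)
      show "(if 0 < X \<omega> then F (t / X \<omega>) else 0) \<le> u * b t * scaled_tail T t \<omega> +
        K * G t * (if t / T < X \<omega> then max_powr \<alpha> \<epsilon> (X \<omega>) else 0)"
      proof (cases "0 < X \<omega>")
        case True
        show ?thesis
        proof (cases "T \<le> t / X \<omega>")
          case T': True
          then have "F (t / X \<omega>) \<le> u * b t * scaled_tail T t \<omega>"
            using T(2)[OF T'] True b_pos[of t] by (simp add: scaled_tail_def)
          then show ?thesis using nn True by simp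
        next
          case False
          then have "t / T < X \<omega>" using True T(1) by (simp add: field_simps)
          moreover have "F (t / X \<omega>) \<le> \<P>(s in N. \<bar>s\<bar> > t / X \<omega>)"
            unfolding F_def by (intro M2.finite_measure_mono) auto
          moreover have "\<dots> \<le> K * G t * max_powr \<alpha> \<epsilon> (X \<omega>)" using True t by (intro N_tail_scale_le)
          ultimately show ?thesis using False True by (simp add: scaled_tail_def)
        qed
      next
        case False
        then show ?thesis using nn by (simp add: scaled_tail_def)
      qed
    qed
    also have "\<dots> = u * b t * (\<integral>\<omega>. scaled_tail T t \<omega> \<partial>M) + K * G t * I t"
      unfolding I_def using int_I scaled_tail_integrable[OF that, of T]
      by (subst Bochner_Integration.integral_add) auto
    also have "K * G t * I t \<le> K * (C * b t) * I t"
    proof (intro mult_right_mono mult_left_mono G_le that K_nonneg)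
      show "0 \<le> I t" unfolding I_def by (intro integral_nonneg_AE AE_I2) (auto simp: max_powr_nonneg)
    qed
    finally show ?thesis by (simp add: algebra_simps)
  qed
  have "filterlim (\<lambda>t. 1 / T * t) at_top at_top"
    using T(1) by (intro filterlim_tendsto_pos_mult_at_top[OF tendsto_const _ filterlim_ident]) auto
  then have "(I \<longlongrightarrow> 0) at_top" unfolding I_def by (intro truncated_mean_tendsto_0) simp
  then have "((\<lambda>t. (\<integral>\<omega>. scaled_tail T t \<omega> \<partial>M) * u + K * C * I t) \<longlongrightarrow> X_moment * u + K * C * 0) at_top"
    by (intro tendsto_intros scaled_tail_mean_tendsto)
  then have "eventually (\<lambda>t. (\<integral>\<omega>. scaled_tail T t \<omega> \<partial>M) * u + K * C * I t < X_moment * u + \<delta>) at_top"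
    using assms(2) by (intro order_tendstoD(2)) auto
  then show ?thesis using eventually_ge_at_top[of x0]
  proof eventually_elim
    case (elim t)
    show ?case
      using le[OF elim(2)] mult_right_mono[OF less_imp_le[OF elim(1)] less_imp_le[OF b_pos[of t]]] by linarith
  qed
qed

lemma mult_tail_lower:
  assumes "eventually (\<lambda>t. u * b t \<le> \<P>(s in N. s > t)) at_top" and "\<delta> > 0"
  shows "eventually (\<lambda>t. (X_moment * u - \<delta>) * b t \<le> \<P>(z in M \<Otimes>\<^sub>M N. X (fst z) * snd z > t)) at_top"
proof -
  define F where "F t = \<P>(s in N. s > t)" for t
  have F_meas [measurable]: "F \<in> borel_measurable borel" unfolding F_def by measurable
  obtain T where T: "\<And>t. T \<le> t \<Longrightarrow> u * b t \<le> F t"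
    using assms(1) by (auto simp: F_def eventually_at_top_linorder)
  have ge: "((\<integral>\<omega>. scaled_tail T t \<omega> \<partial>M) * u) * b t \<le> \<P>(z in M \<Otimes>\<^sub>M N. X (fst z) * snd z > t)"
    if "x0 \<le> t" for t
  proof -
    have t: "0 < t" using that x0 by simp
    have "((\<integral>\<omega>. scaled_tail T t \<omega> \<partial>M) * u) * b t = (\<integral>\<omega>. u * b t * scaled_tail T t \<omega> \<partial>M)" by simp
    also have "\<dots> \<le> (\<integral>\<omega>. (if 0 < X \<omega> then F (t / X \<omega>) else 0) \<partial>M)"
    proof (intro integral_mono integrable_mult_right scaled_tail_integrable that)
      show "integrable M (\<lambda>\<omega>. if 0 < X \<omega> then F (t / X \<omega>) else 0)"
        by (intro integrable_if_bounded) (auto simp: F_def)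
      show "u * b t * scaled_tail T t \<omega> \<le> (if 0 < X \<omega> then F (t / X \<omega>) else 0)" for \<omega>
        using T[of "t / X \<omega>"] b_pos[of t] by (auto simp: scaled_tail_def F_def)
    qed
    also have "\<dots> = \<P>(z in M \<Otimes>\<^sub>M N. X (fst z) * snd z > t)"
      unfolding F_def using t by (intro prob_mult_gt[symmetric]) auto
    finally show ?thesis .
  qed
  have "((\<lambda>t. (\<integral>\<omega>. scaled_tail T t \<omega> \<partial>M) * u) \<longlongrightarrow> X_moment * u) at_top"
    by (intro tendsto_intros scaled_tail_mean_tendsto)
  then have "eventually (\<lambda>t. X_moment * u - \<delta> < (\<integral>\<omega>. scaled_tail T t \<omega> \<partial>M) * u) at_top"
    using assms(2) by (intro order_tendstoD(1)) auto
  then show ?thesis using eventually_ge_at_top[of x0]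
  proof eventually_elim
    case (elim t)
    show ?case
      using ge[OF elim(2)] mult_right_mono[OF less_imp_le[OF elim(1)] less_imp_le[OF b_pos[of t]]] by linarith
  qed
qed

end

lemma powr_near_1:
  fixes v w \<alpha> :: real
  assumes "v < w"
  shows "\<exists>\<eta>. 0 < \<eta> \<and> \<eta> < 1 \<and> v * (1 - \<eta>) powr (- \<alpha>) < w"
    and "\<exists>\<eta>. 0 < \<eta> \<and> - w * (1 + \<eta>) powr (- \<alpha>) < - v"
proof -
  have near: "eventually (\<lambda>\<eta>::real. 0 < \<eta> \<and> \<eta> < 1) (at_right 0)"
    by (simp add: eventually_at_right_field) (auto intro: exI[of _ 1])
  have "((\<lambda>\<eta>. v * (1 - \<eta>) powr (- \<alpha>)) \<longlongrightarrow> v * (1 - 0) powr (- \<alpha>)) (at_right 0)"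
    by (intro tendsto_intros) auto
  then have "eventually (\<lambda>\<eta>. v * (1 - \<eta>) powr (- \<alpha>) < w) (at_right 0)"
    using assms by (intro order_tendstoD(2)) auto
  with near have "eventually (\<lambda>\<eta>. 0 < \<eta> \<and> \<eta> < 1 \<and> v * (1 - \<eta>) powr (- \<alpha>) < w) (at_right 0)"
    by eventually_elim auto
  then show "\<exists>\<eta>. 0 < \<eta> \<and> \<eta> < 1 \<and> v * (1 - \<eta>) powr (- \<alpha>) < w"
    using eventually_happens trivial_limit_at_right_real by blast
  have "((\<lambda>\<eta>. - w * (1 + \<eta>) powr (- \<alpha>)) \<longlongrightarrow> - w * (1 + 0) powr (- \<alpha>)) (at_right 0)"
    by (intro tendsto_intros) auto
  then have "eventually (\<lambda>\<eta>. - w * (1 + \<eta>) powr (- \<alpha>) < - v) (at_right 0)"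
    using assms by (intro order_tendstoD(2)) auto
  with near have "eventually (\<lambda>\<eta>. 0 < \<eta> \<and> - w * (1 + \<eta>) powr (- \<alpha>) < - v) (at_right 0)"
    by eventually_elim auto
  then show "\<exists>\<eta>. 0 < \<eta> \<and> - w * (1 + \<eta>) powr (- \<alpha>) < - v"
    using eventually_happens trivial_limit_at_right_real by blast
qed

lemma eventually_scale:
  fixes P :: "real \<Rightarrow> bool"
  assumes "eventually P at_top" "0 < c"
  shows "eventually (\<lambda>t. P (c * t)) at_top"
  using filterlim_tendsto_pos_mult_at_top[OF tendsto_const assms(2) filterlim_ident] assms(1)
  by (auto simp: filterlim_iff)

context affine_step_tail begin

text \<open>
  The single big jump: \<open>X s + B\<close> is large essentially if and only if one of \<open>X s\<close> and \<open>B\<close> is,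
  since a joint exceedance is negligible even though \<open>X\<close> and \<open>B\<close> may depend on each other.
\<close>
lemma step_tail_upper:
  assumes F: "eventually (\<lambda>t. \<P>(s in N. s > t) \<le> u * b t) at_top"
    and p: "((\<lambda>t. \<P>(\<omega> in M. B \<omega> > t) / b t) \<longlongrightarrow> p) at_top" and "\<delta> > 0"
  shows "eventually (\<lambda>t. \<P>(z in M \<Otimes>\<^sub>M N. X (fst z) * snd z + B (fst z) > t) \<le> (X_moment * u + p + \<delta>) * b t) at_top"
proof -
  let ?Q = "\<lambda>t. \<P>(z in M \<Otimes>\<^sub>M N. X (fst z) * snd z + B (fst z) > t)"
  let ?J = "\<lambda>\<eta> t. \<P>(z in M \<Otimes>\<^sub>M N. X (fst z) * \<bar>snd z\<bar> > \<eta> * t \<and> \<bar>B (fst z)\<bar> > \<eta> * t)"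
  define v where "v = X_moment * u + p + \<delta> / 2"
  obtain \<eta> where \<eta>: "0 < \<eta>" "\<eta> < 1" "v * (1 - \<eta>) powr (- \<alpha>) < X_moment * u + p + \<delta>"
    using powr_near_1(1)[of v "X_moment * u + p + \<delta>"] \<open>\<delta> > 0\<close> by (auto simp: v_def)
  have decomp: "?Q t \<le> \<P>(z in M \<Otimes>\<^sub>M N. X (fst z) * snd z > (1 - \<eta>) * t) + \<P>(\<omega> in M. B \<omega> > (1 - \<eta>) * t) + ?J \<eta> t" for t
  proof -
    have "?Q t \<le> measure (M \<Otimes>\<^sub>M N) (({z \<in> space (M \<Otimes>\<^sub>M N). X (fst z) * snd z > (1 - \<eta>) * t} \<union>
        {z \<in> space (M \<Otimes>\<^sub>M N). B (fst z) > (1 - \<eta>) * t}) \<union>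
        {z \<in> space (M \<Otimes>\<^sub>M N). X (fst z) * \<bar>snd z\<bar> > \<eta> * t \<and> \<bar>B (fst z)\<bar> > \<eta> * t})"
    proof (intro P.finite_measure_mono subsetI)
      fix z assume z: "z \<in> {z \<in> space (M \<Otimes>\<^sub>M N). X (fst z) * snd z + B (fst z) > t}"
      have "X (fst z) * snd z \<le> X (fst z) * \<bar>snd z\<bar>" using X_nonneg by (intro mult_left_mono) auto
      moreover have "(1 - \<eta>) * t + \<eta> * t = t" by (simp add: algebra_simps)
      ultimately show "z \<in> ({z \<in> space (M \<Otimes>\<^sub>M N). X (fst z) * snd z > (1 - \<eta>) * t} \<union>
        {z \<in> space (M \<Otimes>\<^sub>M N). B (fst z) > (1 - \<eta>) * t}) \<union>
        {z \<in> space (M \<Otimes>\<^sub>M N). X (fst z) * \<bar>snd z\<bar> > \<eta> * t \<and> \<bar>B (fst z)\<bar> > \<eta> * t}"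
        using z by auto
    qed measurable
    also have "\<dots> \<le> measure (M \<Otimes>\<^sub>M N) ({z \<in> space (M \<Otimes>\<^sub>M N). X (fst z) * snd z > (1 - \<eta>) * t} \<union>
        {z \<in> space (M \<Otimes>\<^sub>M N). B (fst z) > (1 - \<eta>) * t}) + ?J \<eta> t"
      by (intro measure_Un_le) measurable
    also have "measure (M \<Otimes>\<^sub>M N) ({z \<in> space (M \<Otimes>\<^sub>M N). X (fst z) * snd z > (1 - \<eta>) * t} \<union>
        {z \<in> space (M \<Otimes>\<^sub>M N). B (fst z) > (1 - \<eta>) * t}) \<le>
        \<P>(z in M \<Otimes>\<^sub>M N. X (fst z) * snd z > (1 - \<eta>) * t) + \<P>(z in M \<Otimes>\<^sub>M N. B (fst z) > (1 - \<eta>) * t)"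
      by (intro measure_Un_le) measurable
    also have "\<P>(z in M \<Otimes>\<^sub>M N. B (fst z) > (1 - \<eta>) * t) = \<P>(\<omega> in M. B \<omega> > (1 - \<eta>) * t)"
      by (rule prob_fst) measurable
    finally show ?thesis by simp
  qed
  have "eventually (\<lambda>t. \<P>(\<omega> in M. B \<omega> > t) / b t < p + \<delta> / 4) at_top"
    using \<open>\<delta> > 0\<close> by (intro order_tendstoD(2)[OF p]) auto
  moreover have "eventually (\<lambda>t. \<P>(z in M \<Otimes>\<^sub>M N. X (fst z) * snd z > t) \<le> (X_moment * u + \<delta> / 4) * b t) at_top"
    using \<open>\<delta> > 0\<close> by (intro mult_tail_upper F) auto
  ultimately have "eventually (\<lambda>t. \<P>(z in M \<Otimes>\<^sub>M N. X (fst z) * snd z > t) + \<P>(\<omega> in M. B \<omega> > t) \<le> v * b t) at_top"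
  proof eventually_elim
    case (elim t)
    from elim(1) have "\<P>(\<omega> in M. B \<omega> > t) < (p + \<delta> / 4) * b t"
      using b_pos[of t] by (simp add: pos_divide_less_eq)
    with elim(2) show ?case by (simp add: v_def algebra_simps)
  qed
  then have "eventually (\<lambda>t. \<P>(z in M \<Otimes>\<^sub>M N. X (fst z) * snd z > (1 - \<eta>) * t) + \<P>(\<omega> in M. B \<omega> > (1 - \<eta>) * t)
      \<le> v * b ((1 - \<eta>) * t)) at_top"
    using \<eta> by (intro eventually_scale) auto
  moreover have "((\<lambda>t. v * (b ((1 - \<eta>) * t) / b t) + ?J \<eta> t / b t) \<longlongrightarrow> v * (1 - \<eta>) powr (- \<alpha>) + 0) at_top"
    using \<eta> by (intro tendsto_add tendsto_mult tendsto_const b_scale joint_exceedance_negligible) auto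
  then have "eventually (\<lambda>t. v * (b ((1 - \<eta>) * t) / b t) + ?J \<eta> t / b t < X_moment * u + p + \<delta>) at_top"
    using \<eta> by (intro order_tendstoD(2)) auto
  ultimately show ?thesis
  proof eventually_elim
    case (elim t)
    then have "v * b ((1 - \<eta>) * t) + ?J \<eta> t < (X_moment * u + p + \<delta>) * b t"
      using b_pos[of t] by (simp add: add_divide_distrib[symmetric] pos_divide_less_eq)
    with elim(1) decomp[of t] show ?case by linarith
  qed
qed

lemma step_tail_lower:
  assumes F: "eventually (\<lambda>t. u * b t \<le> \<P>(s in N. s > t)) at_top"
    and p: "((\<lambda>t. \<P>(\<omega> in M. B \<omega> > t) / b t) \<longlongrightarrow> p) at_top" and "\<delta> > 0"
  shows "eventually (\<lambda>t. (X_moment * u + p - \<delta>) * b t \<le> \<P>(z in M \<Otimes>\<^sub>M N. X (fst z) * snd z + B (fst z) > t)) at_top"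
proof -
  let ?Q = "\<lambda>t. \<P>(z in M \<Otimes>\<^sub>M N. X (fst z) * snd z + B (fst z) > t)"
  let ?J = "\<lambda>\<eta> t. \<P>(z in M \<Otimes>\<^sub>M N. X (fst z) * \<bar>snd z\<bar> > \<eta> * t \<and> \<bar>B (fst z)\<bar> > \<eta> * t)"
  define v where "v = X_moment * u + p - \<delta> / 2"
  obtain \<eta> where \<eta>: "0 < \<eta>" "- v * (1 + \<eta>) powr (- \<alpha>) < - (X_moment * u + p - \<delta>)"
    using powr_near_1(2)[of "X_moment * u + p - \<delta>" v] \<open>\<delta> > 0\<close> by (auto simp: v_def)
  have decomp: "\<P>(z in M \<Otimes>\<^sub>M N. X (fst z) * snd z > (1 + \<eta>) * t) + \<P>(\<omega> in M. B \<omega> > (1 + \<eta>) * t) \<le> ?Q t + ?J \<eta> t"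
    if t: "0 < t" for t
  proof -
    let ?U = "{z \<in> space (M \<Otimes>\<^sub>M N). X (fst z) * snd z > (1 + \<eta>) * t}"
    let ?V = "{z \<in> space (M \<Otimes>\<^sub>M N). B (fst z) > (1 + \<eta>) * t}"
    let ?Jt = "{z \<in> space (M \<Otimes>\<^sub>M N). X (fst z) * \<bar>snd z\<bar> > \<eta> * t \<and> \<bar>B (fst z)\<bar> > \<eta> * t}"
    let ?Qt = "{z \<in> space (M \<Otimes>\<^sub>M N). X (fst z) * snd z + B (fst z) > t}"
    have [measurable]: "?U \<in> sets (M \<Otimes>\<^sub>M N)" "?V \<in> sets (M \<Otimes>\<^sub>M N)" "?Jt \<in> sets (M \<Otimes>\<^sub>M N)" "?Qt \<in> sets (M \<Otimes>\<^sub>M N)"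
      by measurable
    have "measure (M \<Otimes>\<^sub>M N) ?V = \<P>(\<omega> in M. B \<omega> > (1 + \<eta>) * t)" by (rule prob_fst) measurable
    moreover have "measure (M \<Otimes>\<^sub>M N) ?U + measure (M \<Otimes>\<^sub>M N) ?V =
        measure (M \<Otimes>\<^sub>M N) (?U \<union> ?V) + measure (M \<Otimes>\<^sub>M N) (?U \<inter> ?V)"
      by (subst P.finite_measure_Union') (auto simp: P.finite_measure_Diff' Int_commute)
    moreover have incl: "?U \<union> ?V \<subseteq> ?Qt \<union> (?Jt - ?Qt)" "?U \<inter> ?V \<subseteq> ?Jt \<inter> ?Qt"
    proof -
      have pos: "0 < \<eta> * t" using \<eta> t by simp
      have eq: "(1 + \<eta>) * t = t + \<eta> * t" by (simp add: algebra_simps)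
      have le: "X (fst z) * snd z \<le> X (fst z) * \<bar>snd z\<bar>" "- (X (fst z) * snd z) \<le> X (fst z) * \<bar>snd z\<bar>" for z :: "'a \<times> real"
        using mult_left_mono[of "snd z" "\<bar>snd z\<bar>" "X (fst z)"] mult_left_mono[of "- snd z" "\<bar>snd z\<bar>" "X (fst z)"] X_nonneg
        by auto
      show "?U \<union> ?V \<subseteq> ?Qt \<union> (?Jt - ?Qt)"
      proof
        fix z assume "z \<in> ?U \<union> ?V"
        then show "z \<in> ?Qt \<union> (?Jt - ?Qt)" using le[of z] pos t unfolding eq by auto
      qed
      show "?U \<inter> ?V \<subseteq> ?Jt \<inter> ?Qt"
      proof
        fix z assume "z \<in> ?U \<inter> ?V"
        then show "z \<in> ?Jt \<inter> ?Qt" using le[of z] pos t unfolding eq by auto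
      qed
    qed
    moreover have "measure (M \<Otimes>\<^sub>M N) (?U \<union> ?V) \<le> measure (M \<Otimes>\<^sub>M N) (?Qt \<union> (?Jt - ?Qt))"
      using incl(1) by (intro P.finite_measure_mono) auto
    moreover have "measure (M \<Otimes>\<^sub>M N) (?U \<inter> ?V) \<le> measure (M \<Otimes>\<^sub>M N) (?Jt \<inter> ?Qt)"
      using incl(2) by (intro P.finite_measure_mono) auto
    moreover have "measure (M \<Otimes>\<^sub>M N) (?Qt \<union> (?Jt - ?Qt)) = measure (M \<Otimes>\<^sub>M N) ?Qt + measure (M \<Otimes>\<^sub>M N) (?Jt - ?Qt)"
      by (intro P.finite_measure_Union) auto
    moreover have "measure (M \<Otimes>\<^sub>M N) (?Jt - ?Qt) = measure (M \<Otimes>\<^sub>M N) ?Jt - measure (M \<Otimes>\<^sub>M N) (?Jt \<inter> ?Qt)"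
      by (intro P.finite_measure_Diff') auto
    ultimately show ?thesis by linarith
  qed
  have "eventually (\<lambda>t. p - \<delta> / 4 < \<P>(\<omega> in M. B \<omega> > t) / b t) at_top"
    using \<open>\<delta> > 0\<close> by (intro order_tendstoD(1)[OF p]) auto
  moreover have "eventually (\<lambda>t. (X_moment * u - \<delta> / 4) * b t \<le> \<P>(z in M \<Otimes>\<^sub>M N. X (fst z) * snd z > t)) at_top"
    using \<open>\<delta> > 0\<close> by (intro mult_tail_lower F) auto
  ultimately have "eventually (\<lambda>t. v * b t \<le> \<P>(z in M \<Otimes>\<^sub>M N. X (fst z) * snd z > t) + \<P>(\<omega> in M. B \<omega> > t)) at_top"
  proof eventually_elim
    case (elim t)
    from elim(1) have "(p - \<delta> / 4) * b t < \<P>(\<omega> in M. B \<omega> > t)"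
      using b_pos[of t] by (simp add: pos_less_divide_eq)
    with elim(2) show ?case by (simp add: v_def algebra_simps)
  qed
  then have "eventually (\<lambda>t. v * b ((1 + \<eta>) * t) \<le>
      \<P>(z in M \<Otimes>\<^sub>M N. X (fst z) * snd z > (1 + \<eta>) * t) + \<P>(\<omega> in M. B \<omega> > (1 + \<eta>) * t)) at_top"
    using \<eta> by (intro eventually_scale) auto
  moreover have "((\<lambda>t. v * (b ((1 + \<eta>) * t) / b t) - ?J \<eta> t / b t) \<longlongrightarrow> v * (1 + \<eta>) powr (- \<alpha>) - 0) at_top"
    using \<eta> by (intro tendsto_diff tendsto_mult tendsto_const b_scale joint_exceedance_negligible) auto
  then have "eventually (\<lambda>t. X_moment * u + p - \<delta> < v * (b ((1 + \<eta>) * t) / b t) - ?J \<eta> t / b t) at_top"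
    using \<eta> by (intro order_tendstoD(1)) auto
  ultimately show ?thesis using eventually_gt_at_top[of 0]
  proof eventually_elim
    case (elim t)
    then have "(X_moment * u + p - \<delta>) * b t < v * b ((1 + \<eta>) * t) - ?J \<eta> t"
      using b_pos[of t] by (simp add: diff_divide_distrib[symmetric] pos_less_divide_eq)
    with elim(1) decomp[OF elim(3)] show ?case by linarith
  qed
qed

lemma X_moment_nonneg: "0 \<le> X_moment"
  unfolding X_moment_def by (intro integral_nonneg_AE) auto

lemma step_tail_limit:
  assumes F: "((\<lambda>t. \<P>(s in N. s > t) / b t) \<longlongrightarrow> u) at_top"
    and p: "((\<lambda>t. \<P>(\<omega> in M. B \<omega> > t) / b t) \<longlongrightarrow> p) at_top"
  shows "((\<lambda>t. \<P>(z in M \<Otimes>\<^sub>M N. X (fst z) * snd z + B (fst z) > t) / b t) \<longlongrightarrow> X_moment * u + p) at_top"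
proof (rule order_tendstoI)
  define d where "d \<delta> = \<delta> / (2 * (X_moment + 1))" for \<delta> :: real
  have d: "0 < d \<delta>" "X_moment * d \<delta> < \<delta> / 2" if "0 < \<delta>" for \<delta>
    using that X_moment_nonneg by (auto simp: d_def field_simps)
  fix a assume "a < X_moment * u + p"
  define \<delta> where "\<delta> = X_moment * u + p - a"
  have \<delta>: "0 < \<delta>" using \<open>a < _\<close> by (simp add: \<delta>_def)
  have "eventually (\<lambda>t. u - d \<delta> < \<P>(s in N. s > t) / b t) at_top"
    using d(1)[OF \<delta>] by (intro order_tendstoD(1)[OF F]) auto
  then have "eventually (\<lambda>t. (u - d \<delta>) * b t \<le> \<P>(s in N. s > t)) at_top"
    by eventually_elim (use b_pos in \<open>simp add: pos_less_divide_eq less_imp_le\<close>)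
  then have "eventually (\<lambda>t. (X_moment * (u - d \<delta>) + p - \<delta> / 2) * b t \<le>
      \<P>(z in M \<Otimes>\<^sub>M N. X (fst z) * snd z + B (fst z) > t)) at_top"
    using \<delta> by (intro step_tail_lower p) auto
  then show "eventually (\<lambda>t. a < \<P>(z in M \<Otimes>\<^sub>M N. X (fst z) * snd z + B (fst z) > t) / b t) at_top"
  proof eventually_elim
    case (elim t)
    have "a < X_moment * (u - d \<delta>) + p - \<delta> / 2"
    proof -
      have "a = X_moment * u + p - \<delta>" by (simp add: \<delta>_def)
      with d(2)[OF \<delta>] show ?thesis by (simp add: right_diff_distrib)
    qed
    also have "\<dots> \<le> \<P>(z in M \<Otimes>\<^sub>M N. X (fst z) * snd z + B (fst z) > t) / b t"
      using elim b_pos[of t] by (simp add: pos_le_divide_eq)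
    finally show ?case .
  qed
next
  define d where "d \<delta> = \<delta> / (2 * (X_moment + 1))" for \<delta> :: real
  have d: "0 < d \<delta>" "X_moment * d \<delta> < \<delta> / 2" if "0 < \<delta>" for \<delta>
    using that X_moment_nonneg by (auto simp: d_def field_simps)
  fix a assume "X_moment * u + p < a"
  define \<delta> where "\<delta> = a - (X_moment * u + p)"
  have \<delta>: "0 < \<delta>" using \<open>_ < a\<close> by (simp add: \<delta>_def)
  have "eventually (\<lambda>t. \<P>(s in N. s > t) / b t < u + d \<delta>) at_top"
    using d(1)[OF \<delta>] by (intro order_tendstoD(2)[OF F]) auto
  then have "eventually (\<lambda>t. \<P>(s in N. s > t) \<le> (u + d \<delta>) * b t) at_top"
    by eventually_elim (use b_pos in \<open>simp add: pos_divide_less_eq less_imp_le\<close>)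
  then have "eventually (\<lambda>t. \<P>(z in M \<Otimes>\<^sub>M N. X (fst z) * snd z + B (fst z) > t) \<le>
      (X_moment * (u + d \<delta>) + p + \<delta> / 2) * b t) at_top"
    using \<delta> by (intro step_tail_upper p) auto
  then show "eventually (\<lambda>t. \<P>(z in M \<Otimes>\<^sub>M N. X (fst z) * snd z + B (fst z) > t) / b t < a) at_top"
  proof eventually_elim
    case (elim t)
    then have "\<P>(z in M \<Otimes>\<^sub>M N. X (fst z) * snd z + B (fst z) > t) / b t \<le> X_moment * (u + d \<delta>) + p + \<delta> / 2"
      using b_pos[of t] by (simp add: pos_divide_le_eq)
    also have "\<dots> < a"
    proof -
      have "a = X_moment * u + p + \<delta>" by (simp add: \<delta>_def)
      with d(2)[OF \<delta>] show ?thesis by (simp add: distrib_left)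
    qed
    finally show ?case .
  qed
qed

lemma fixed_point_tail_limit:
  assumes fixed: "N = distr (M \<Otimes>\<^sub>M N) borel (\<lambda>z. X (fst z) * snd z + B (fst z))"
    and p: "((\<lambda>t. \<P>(\<omega> in M. B \<omega> > t) / b t) \<longlongrightarrow> p) at_top" and "X_moment < 1"
  shows "((\<lambda>t. \<P>(s in N. s > t) / b t) \<longlongrightarrow> p / (1 - X_moment)) at_top"
proof -
  define F where "F t = \<P>(s in N. s > t)" for t
  have F_fixed: "\<P>(z in M \<Otimes>\<^sub>M N. X (fst z) * snd z + B (fst z) > t) = F t" for t
  proof -
    have "F t = \<P>(s in distr (M \<Otimes>\<^sub>M N) borel (\<lambda>z. X (fst z) * snd z + B (fst z)). s > t)"
      unfolding F_def by (subst fixed) simp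
    also have "\<dots> = \<P>(z in M \<Otimes>\<^sub>M N. X (fst z) * snd z + B (fst z) > t)"
      by (subst measure_distr) (auto intro!: arg_cong[where f = "measure _"])
    finally show ?thesis by simp
  qed
  have F_le: "F t \<le> K * C * b t" if "x0 \<le> t" for t
  proof -
    have "F t \<le> \<P>(s in N. \<bar>s\<bar> > t)" unfolding F_def by (intro M2.finite_measure_mono) auto
    also have "\<dots> \<le> K * G t" using that x0 by (intro N_tail_le) auto
    also have "\<dots> \<le> K * (C * b t)" using that K_nonneg by (intro mult_left_mono G_le)
    finally show ?thesis by simp
  qed
  have F_ge: "0 \<le> F t" for t by (simp add: F_def)
  define D where "D = {u. eventually (\<lambda>t. F t \<le> u * b t) at_top}"
  define D' where "D' = {u. eventually (\<lambda>t. - u * b t \<le> F t) at_top}"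
  have cmp: "u' \<le> u" if "eventually (\<lambda>t. F t \<le> u * b t) at_top" "eventually (\<lambda>t. u' * b t \<le> F t) at_top" for u u'
  proof -
    have "eventually (\<lambda>t. u' * b t \<le> u * b t) at_top" using that by eventually_elim linarith
    then have "\<exists>t. u' * b t \<le> u * b t" using eventually_happens trivial_limit_at_top_linorder by blast
    then show ?thesis using b_pos by (auto simp: mult_le_cancel_right_pos)
  qed
  have KC: "eventually (\<lambda>t. F t \<le> K * C * b t) at_top"
    using eventually_ge_at_top[of x0] by eventually_elim (rule F_le)
  have zero: "eventually (\<lambda>t. 0 * b t \<le> F t) at_top" by (simp add: F_ge)
  show ?thesis
    unfolding F_def[symmetric]
  proof (rule order_tendstoI)
    fix a assume "p / (1 - X_moment) < a"
    then have "\<exists>u\<in>D. u < a"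
    proof (rule affine_invariant_set_below[OF _ _ X_moment_nonneg \<open>X_moment < 1\<close>, rotated -1])
      show "D \<noteq> {}" using KC by (auto simp: D_def)
      show "bdd_below D" using cmp[OF _ zero] by (intro bdd_belowI[of _ 0]) (simp add: D_def)
      show "X_moment * u + p + \<delta> \<in> D" if "u \<in> D" "\<delta> > 0" for u \<delta>
        using step_tail_upper[of u p \<delta>] that p unfolding D_def F_fixed by (simp add: F_def)
    qed
    then obtain u where "u < a" "eventually (\<lambda>t. F t \<le> u * b t) at_top" by (auto simp: D_def)
    from this(2) show "eventually (\<lambda>t. F t / b t < a) at_top"
    proof eventually_elim
      case (elim t)
      then have "F t / b t \<le> u" using b_pos[of t] by (simp add: pos_divide_le_eq)
      then show ?case using \<open>u < a\<close> by linarith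
    qed
  next
    fix a assume "a < p / (1 - X_moment)"
    then have "- p / (1 - X_moment) < - a" by simp
    then have "\<exists>u\<in>D'. u < - a"
    proof (rule affine_invariant_set_below[OF _ _ X_moment_nonneg \<open>X_moment < 1\<close>, rotated -1])
      show "D' \<noteq> {}" using zero by (auto simp: D'_def intro!: exI[of _ 0])
      show "bdd_below D'"
      proof (rule bdd_belowI)
        fix x assume "x \<in> D'"
        then show "- (K * C) \<le> x" using cmp[OF KC, of "- x"] by (simp add: D'_def)
      qed
      show "X_moment * u + - p + \<delta> \<in> D'" if "u \<in> D'" "\<delta> > 0" for u \<delta>
        using step_tail_lower[of "- u" p \<delta>] that p unfolding D'_def F_fixed
        by (simp add: F_def algebra_simps)
    qed
    then obtain u where "u < - a" "eventually (\<lambda>t. - u * b t \<le> F t) at_top" by (auto simp: D'_def)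
    from this(2) show "eventually (\<lambda>t. a < F t / b t) at_top"
    proof eventually_elim
      case (elim t)
      then have "- u \<le> F t / b t" using b_pos[of t] by (simp add: pos_le_divide_eq)
      then show ?case using \<open>u < - a\<close> by linarith
    qed
  qed
qed

end

section \<open>From the tail hypotheses to the fixed point\<close>

lemma asymp_mult_imp_tendsto:
  assumes "asymp_mult f c g" and pos: "\<And>t. t > 0 \<Longrightarrow> g t > 0"
  shows "((\<lambda>t. f t / g t) \<longlongrightarrow> c) at_top"
proof (cases "c = 0")
  case True
  with assms(1) show ?thesis by (simp add: asymp_mult_def smalloD_tendsto)
next
  case False
  with assms(1) have "f \<sim>[at_top] (\<lambda>t. c * g t)" by (simp add: asymp_mult_def)
  moreover have "eventually (\<lambda>t. f t \<noteq> 0 \<or> c * g t \<noteq> 0) at_top"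
    using eventually_gt_at_top[of 0] by eventually_elim (use pos False in force)
  ultimately have "((\<lambda>t. f t / (c * g t)) \<longlongrightarrow> 1) at_top" by (rule asymp_equivD_strong)
  then have "((\<lambda>t. c * (f t / (c * g t))) \<longlongrightarrow> c * 1) at_top" by (intro tendsto_mult tendsto_const)
  then show ?thesis using False by simp
qed

lemma (in prob_space) two_sided_tail:
  fixes B :: "'a \<Rightarrow> real"
  assumes [measurable]: "B \<in> borel_measurable M" and "0 \<le> t"
  shows "\<P>(\<omega> in M. \<bar>B \<omega>\<bar> > t) = \<P>(\<omega> in M. B \<omega> > t) + \<P>(\<omega> in M. B \<omega> < - t)"
proof -
  have "{\<omega> \<in> space M. \<bar>B \<omega>\<bar> > t} = {\<omega> \<in> space M. B \<omega> > t} \<union> {\<omega> \<in> space M. B \<omega> < - t}" using assms(2) by auto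
  then show ?thesis using assms(2) by (simp add: finite_measure_Union disjoint_iff)
qed

lemma (in prob_space) tail_regular:
  fixes B :: "'a \<Rightarrow> real" and \<alpha> :: real
  assumes B [measurable]: "B \<in> borel_measurable M" and \<alpha>: "0 < \<alpha>" and L: "slowly_varying L"
    and pq: "p + q = 1"
    and p: "asymp_mult (\<lambda>t. \<P>(\<omega> in M. B \<omega> > t)) p (\<lambda>t. t powr (- \<alpha>) * L t)"
    and q: "asymp_mult (\<lambda>t. \<P>(\<omega> in M. B \<omega> < - t)) q (\<lambda>t. t powr (- \<alpha>) * L t)"
  defines "b \<equiv> \<lambda>t. \<P>(\<omega> in M. \<bar>B \<omega>\<bar> > t)"
  shows "regular_tail b \<alpha>"
    and "((\<lambda>t. \<P>(\<omega> in M. B \<omega> > t) / b t) \<longlongrightarrow> p) at_top"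
    and "((\<lambda>t. \<P>(\<omega> in M. B \<omega> < - t) / b t) \<longlongrightarrow> q) at_top"
    and "((\<lambda>t. b t / (t powr (- \<alpha>) * L t)) \<longlongrightarrow> 1) at_top"
proof -
  define g where "g t = t powr (- \<alpha>) * L t" for t
  have g_pos: "g t > 0" if "t > 0" for t using L that by (simp add: g_def slowly_varying_def)
  have pg: "((\<lambda>t. \<P>(\<omega> in M. B \<omega> > t) / g t) \<longlongrightarrow> p) at_top"
    using asymp_mult_imp_tendsto[OF p] g_pos by (simp add: g_def)
  have qg: "((\<lambda>t. \<P>(\<omega> in M. B \<omega> < - t) / g t) \<longlongrightarrow> q) at_top"
    using asymp_mult_imp_tendsto[OF q] g_pos by (simp add: g_def)
  have "((\<lambda>t. \<P>(\<omega> in M. B \<omega> > t) / g t + \<P>(\<omega> in M. B \<omega> < - t) / g t) \<longlongrightarrow> 1) at_top"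
    using tendsto_add[OF pg qg] pq by simp
  moreover have "eventually (\<lambda>t. \<P>(\<omega> in M. B \<omega> > t) / g t + \<P>(\<omega> in M. B \<omega> < - t) / g t = b t / g t) at_top"
    using eventually_ge_at_top[of 0]
    by eventually_elim (simp add: b_def two_sided_tail[OF B] add_divide_distrib)
  ultimately have bg: "((\<lambda>t. b t / g t) \<longlongrightarrow> 1) at_top" by (rule Lim_transform_eventually)
  then show "((\<lambda>t. b t / (t powr (- \<alpha>) * L t)) \<longlongrightarrow> 1) at_top" by (simp add: g_def)
  have mono: "b t \<le> b s" if "s \<le> t" for s t
    unfolding b_def using that by (intro finite_measure_mono) auto
  have "eventually (\<lambda>t. 1 / 2 < b t / g t) at_top" by (intro order_tendstoD(1)[OF bg]) auto
  with eventually_gt_at_top[of 0] have ev: "eventually (\<lambda>t. 0 < b t) at_top"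
  proof eventually_elim
    case (elim t)
    have "0 < b t / g t" using elim(2) by linarith
    then show ?case using g_pos[OF elim(1)] by (simp add: zero_less_divide_iff)
  qed
  have pos: "0 < b t" for t
  proof -
    obtain s where "t \<le> s" "0 < b s"
      using eventually_happens'[OF _ eventually_conj[OF ev eventually_ge_at_top[of t]]] by auto
    then show ?thesis using mono[of t s] by linarith
  qed
  have over: "((\<lambda>t. f t / b t) \<longlongrightarrow> c) at_top" if "((\<lambda>t. f t / g t) \<longlongrightarrow> c) at_top" for f c
  proof -
    have "((\<lambda>t. (f t / g t) / (b t / g t)) \<longlongrightarrow> c / 1) at_top" using that bg by (intro tendsto_divide) auto
    moreover have "eventually (\<lambda>t. (f t / g t) / (b t / g t) = f t / b t) at_top"
      using eventually_gt_at_top[of 0] by eventually_elim (use g_pos in force)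
    ultimately show ?thesis by (auto intro: Lim_transform_eventually)
  qed
  from over[OF pg] show "((\<lambda>t. \<P>(\<omega> in M. B \<omega> > t) / b t) \<longlongrightarrow> p) at_top" .
  from over[OF qg] show "((\<lambda>t. \<P>(\<omega> in M. B \<omega> < - t) / b t) \<longlongrightarrow> q) at_top" .
  show "regular_tail b \<alpha>"
  proof
    show "b t \<le> 1" for t by (simp add: b_def)
    fix c :: real assume c: "0 < c"
    have "((\<lambda>t. c powr (- \<alpha>) * (L (c * t) / L t)) \<longlongrightarrow> c powr (- \<alpha>) * 1) at_top"
      using L c by (intro tendsto_mult tendsto_const) (auto simp: slowly_varying_def)
    moreover have "eventually (\<lambda>t. c powr (- \<alpha>) * (L (c * t) / L t) = g (c * t) / g t) at_top"
      using eventually_gt_at_top[of 0] by eventually_elim (use c in \<open>simp add: g_def powr_mult\<close>)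
    ultimately have g_scale: "((\<lambda>t. g (c * t) / g t) \<longlongrightarrow> c powr (- \<alpha>)) at_top"
      by (auto intro: Lim_transform_eventually)
    have "((\<lambda>t. b (c * t) / g (c * t)) \<longlongrightarrow> 1) at_top"
      by (rule filterlim_compose[OF bg]) (rule filterlim_tendsto_pos_mult_at_top[OF tendsto_const c filterlim_ident])
    then have "((\<lambda>t. (b (c * t) / g (c * t)) * (g (c * t) / g t)) \<longlongrightarrow> 1 * c powr (- \<alpha>)) at_top"
      by (intro tendsto_mult g_scale)
    moreover have "eventually (\<lambda>t. (b (c * t) / g (c * t)) * (g (c * t) / g t) = b (c * t) / g t) at_top"
      using eventually_gt_at_top[of 0]
    proof eventually_elim
      case (elim t)
      then show ?case using g_pos[of "c * t"] c by simp
    qed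
    ultimately have "((\<lambda>t. b (c * t) / g t) \<longlongrightarrow> c powr (- \<alpha>)) at_top"
      by (auto intro: Lim_transform_eventually)
    then show "((\<lambda>t. b (c * t) / b t) \<longlongrightarrow> c powr (- \<alpha>)) at_top" by (rule over)
  qed (use \<alpha> mono pos in auto)
qed

lemma (in prob_space) max_powr_moment_less_1:
  fixes X :: "'a \<Rightarrow> real"
  assumes [measurable]: "X \<in> borel_measurable M" and X: "\<And>\<omega>. 0 \<le> X \<omega>"
    and \<alpha>: "0 < \<alpha>" and \<epsilon>0: "0 < \<epsilon>0"
    and int: "integrable M (\<lambda>\<omega>. X \<omega> powr (\<alpha> + \<epsilon>0))"
    and less1: "(\<integral>\<omega>. X \<omega> powr \<alpha> \<partial>M) < 1"
  obtains \<epsilon> \<theta> where "0 < \<epsilon>" "\<epsilon> < \<alpha>" "\<epsilon> \<le> \<epsilon>0" "1 < \<theta>"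
    "integrable M (\<lambda>\<omega>. max_powr \<alpha> \<epsilon> (X \<omega>))"
    "integrable M (\<lambda>\<omega>. max_powr \<alpha> \<epsilon> (\<theta> * X \<omega>))"
    "(\<integral>\<omega>. max_powr \<alpha> \<epsilon> (\<theta> * X \<omega>) \<partial>M) < 1"
proof -
  define e where "e n = min \<epsilon>0 (\<alpha> / 2) / (real n + 1)" for n
  have e: "0 < e n" "e n < \<alpha>" "e n \<le> \<epsilon>0" for n
  proof -
    show "0 < e n" using \<alpha> \<epsilon>0 by (simp add: e_def)
    have "e n \<le> min \<epsilon>0 (\<alpha> / 2) / 1" unfolding e_def using \<alpha> \<epsilon>0 by (intro divide_left_mono) auto
    then show "e n < \<alpha>" "e n \<le> \<epsilon>0" using \<alpha> by auto
  qed
  have e_lim: "e \<longlonglongrightarrow> 0" unfolding e_def by real_asymp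
  have w: "integrable M (\<lambda>\<omega>. 1 + X \<omega> powr (\<alpha> + \<epsilon>0))" using int by auto
  have bound: "norm (max_powr \<alpha> (e n) (X \<omega>)) \<le> 1 + X \<omega> powr (\<alpha> + \<epsilon>0)" for n \<omega>
    using max_powr_le[of "X \<omega>" "e n" \<epsilon>0 \<alpha>] X[of \<omega>] e[of n] by (simp add: max_powr_nonneg)
  have "(\<lambda>n. \<integral>\<omega>. max_powr \<alpha> (e n) (X \<omega>) \<partial>M) \<longlonglongrightarrow> (\<integral>\<omega>. X \<omega> powr \<alpha> \<partial>M)"
  proof (rule integral_dominated_convergence[OF _ _ w])
    show "AE \<omega> in M. (\<lambda>n. max_powr \<alpha> (e n) (X \<omega>)) \<longlonglongrightarrow> X \<omega> powr \<alpha>"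
    proof (intro AE_I2)
      fix \<omega>
      show "(\<lambda>n. max_powr \<alpha> (e n) (X \<omega>)) \<longlonglongrightarrow> X \<omega> powr \<alpha>"
      proof (cases "X \<omega> = 0")
        case False
        then have "(\<lambda>n. max (X \<omega> powr (\<alpha> + e n)) (X \<omega> powr (\<alpha> - e n))) \<longlonglongrightarrow>
            max (X \<omega> powr (\<alpha> + 0)) (X \<omega> powr (\<alpha> - 0))"
          by (intro tendsto_max tendsto_powr tendsto_intros e_lim)
        then show ?thesis by (simp add: max_powr_def)
      qed simp
    qed
  qed (use bound in auto)
  then have "eventually (\<lambda>n. (\<integral>\<omega>. max_powr \<alpha> (e n) (X \<omega>) \<partial>M) < 1) sequentially"
    using less1 by (rule order_tendstoD(2))
  then obtain n where n: "(\<integral>\<omega>. max_powr \<alpha> (e n) (X \<omega>) \<partial>M) < 1"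
    using eventually_happens' sequentially_bot by blast
  define \<epsilon> where "\<epsilon> = e n"
  have int1: "integrable M (\<lambda>\<omega>. max_powr \<alpha> \<epsilon> (X \<omega>))"
    unfolding \<epsilon>_def using bound[of n]
    by (intro Bochner_Integration.integrable_bound[OF w]) (auto intro!: AE_I2 intro: order.trans[OF _ abs_ge_self])
  let ?I = "\<integral>\<omega>. max_powr \<alpha> \<epsilon> (X \<omega>) \<partial>M"
  have "((\<lambda>\<theta>. max_powr \<alpha> \<epsilon> \<theta> * ?I) \<longlongrightarrow> max_powr \<alpha> \<epsilon> 1 * ?I) (at_right 1)"
    unfolding max_powr_def[of \<alpha> \<epsilon>, abs_def] by (intro tendsto_intros tendsto_max) auto
  then have "eventually (\<lambda>\<theta>. max_powr \<alpha> \<epsilon> \<theta> * ?I < 1) (at_right 1)"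
    using n by (intro order_tendstoD(2)) (auto simp: \<epsilon>_def max_powr_def)
  moreover have "eventually (\<lambda>\<theta>::real. 1 < \<theta>) (at_right 1)" by (simp add: eventually_at_right_less)
  ultimately have "eventually (\<lambda>\<theta>. 1 < \<theta> \<and> max_powr \<alpha> \<epsilon> \<theta> * ?I < 1) (at_right 1)" by eventually_elim auto
  then obtain \<theta> where \<theta>: "1 < \<theta>" "max_powr \<alpha> \<epsilon> \<theta> * ?I < 1"
    using eventually_happens'[OF trivial_limit_at_right_real] by blast
  have le: "max_powr \<alpha> \<epsilon> (\<theta> * X \<omega>) \<le> max_powr \<alpha> \<epsilon> \<theta> * max_powr \<alpha> \<epsilon> (X \<omega>)" for \<omega>
    using \<theta>(1) X by (intro max_powr_mult_le) auto
  have int2: "integrable M (\<lambda>\<omega>. max_powr \<alpha> \<epsilon> (\<theta> * X \<omega>))"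
    using le max_powr_nonneg
    by (intro Bochner_Integration.integrable_bound[OF integrable_mult_right[OF int1, of "max_powr \<alpha> \<epsilon> \<theta>"]]) auto
  have "(\<integral>\<omega>. max_powr \<alpha> \<epsilon> (\<theta> * X \<omega>) \<partial>M) \<le> (\<integral>\<omega>. max_powr \<alpha> \<epsilon> \<theta> * max_powr \<alpha> \<epsilon> (X \<omega>) \<partial>M)"
    using le int1 int2 by (intro integral_mono) auto
  also have "\<dots> < 1" using \<theta>(2) by simp
  finally show thesis using that[of \<epsilon> \<theta>] e[of n] \<theta>(1) int1 int2 by (simp add: \<epsilon>_def)
qed

lemma (in affine_step_tail) reflect:
  fixes \<sigma> \<tau> :: real
  assumes \<sigma>: "\<sigma> = 1 \<or> \<sigma> = - 1" and \<tau>: "\<tau> = 1 \<or> \<tau> = - 1"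
    and Y [measurable]: "Y \<in> borel_measurable M" and "\<And>\<omega>. 0 \<le> Y \<omega>"
    and "integrable M (\<lambda>\<omega>. max_powr \<alpha> \<epsilon> (Y \<omega>))"
  shows "affine_step_tail b \<alpha> M (distr N borel (\<lambda>s. \<sigma> * s)) Y (\<lambda>\<omega>. \<tau> * B \<omega>) G C x0 \<epsilon> K"
proof -
  interpret N': prob_space "distr N borel (\<lambda>s. \<sigma> * s)" by (rule M2.prob_space_distr) simp
  interpret R: pair_prob_space M "distr N borel (\<lambda>s. \<sigma> * s)" ..
  show ?thesis
  proof
    have abs: "\<bar>\<sigma> * s\<bar> = \<bar>s\<bar>" "\<bar>\<tau> * s\<bar> = \<bar>s\<bar>" for s using \<sigma> \<tau> by auto
    show "b t = \<P>(\<omega> in M. \<bar>\<tau> * B \<omega>\<bar> > t)" for t by (simp add: abs b_eq)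
    show "\<P>(s in distr N borel (\<lambda>s. \<sigma> * s). \<bar>s\<bar> > t) \<le> K * G t" if "0 < t" for t
      using N_tail_le[OF that] by (subst measure_distr) (auto simp: abs vimage_def)
  qed (use assms x0 C \<epsilon> G_ge G_scale G_le in auto)
qed

lemma fixed_point_affine_step_tail:
  fixes N :: "real measure" and X B :: "'a \<Rightarrow> real"
  assumes "prob_space M" "prob_space N" "sets N = sets borel"
    and meas: "X \<in> borel_measurable M" "B \<in> borel_measurable M" and X: "\<And>\<omega>. 0 \<le> X \<omega>"
    and reg: "regular_tail (\<lambda>t. \<P>(\<omega> in M. \<bar>B \<omega>\<bar> > t)) \<alpha>" and "0 < \<epsilon>0"
    and int: "integrable M (\<lambda>\<omega>. X \<omega> powr (\<alpha> + \<epsilon>0))"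
    and less1: "(\<integral>\<omega>. X \<omega> powr \<alpha> \<partial>M) < 1"
    and fixed: "N = distr (M \<Otimes>\<^sub>M N) borel (\<lambda>z. X (fst z) * snd z + B (fst z))"
  shows "\<exists>G C x0 \<epsilon> K. \<epsilon> \<le> \<epsilon>0 \<and> affine_step_tail (\<lambda>t. \<P>(\<omega> in M. \<bar>B \<omega>\<bar> > t)) \<alpha> M N X B G C x0 \<epsilon> K"
proof -
  interpret M: prob_space M by fact
  interpret N: prob_space N by fact
  interpret pair_prob_space M N ..
  interpret regular_tail "\<lambda>t. \<P>(\<omega> in M. \<bar>B \<omega>\<bar> > t)" \<alpha> by fact
  obtain \<epsilon> \<theta> where \<epsilon>: "0 < \<epsilon>" "\<epsilon> < \<alpha>" "\<epsilon> \<le> \<epsilon>0" and \<theta>: "1 < \<theta>"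
    and ints: "integrable M (\<lambda>\<omega>. max_powr \<alpha> \<epsilon> (X \<omega>))" "integrable M (\<lambda>\<omega>. max_powr \<alpha> \<epsilon> (\<theta> * X \<omega>))"
    "(\<integral>\<omega>. max_powr \<alpha> \<epsilon> (\<theta> * X \<omega>) \<partial>M) < 1"
    by (rule M.max_powr_moment_less_1[OF meas(1) X \<alpha>_pos \<open>0 < \<epsilon>0\<close> int less1]) (rule that)
  obtain G C x0 where G: "x0 > 0" "C > 0"
    "\<And>t. t > 0 \<Longrightarrow> \<P>(\<omega> in M. \<bar>B \<omega>\<bar> > t) \<le> G t"
    "\<And>t a. t > 0 \<Longrightarrow> a > 0 \<Longrightarrow> G (t / a) \<le> max_powr \<alpha> \<epsilon> a * G t"
    "\<And>t. x0 \<le> t \<Longrightarrow> G t \<le> C * \<P>(\<omega> in M. \<bar>B \<omega>\<bar> > t)"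
    by (rule scaling_majorant[OF \<epsilon>(1,2)]) (rule that)
  interpret S: affine_step "\<lambda>t. \<P>(\<omega> in M. \<bar>B \<omega>\<bar> > t)" \<alpha> M N X B G C x0 \<epsilon>
    by unfold_locales (use assms(3) meas X \<epsilon> G in auto)
  obtain K where K: "\<forall>t>0. \<P>(s in N. \<bar>s\<bar> > t) \<le> K * G t"
    using S.fixed_point_tail_bound[OF fixed \<theta> ints(2,3)] ..
  have "affine_step_tail (\<lambda>t. \<P>(\<omega> in M. \<bar>B \<omega>\<bar> > t)) \<alpha> M N X B G C x0 \<epsilon> K"
    by unfold_locales (use ints K in auto)
  with \<epsilon>(3) show ?thesis by blast
qed

lemma distr_pair_distr_right:
  assumes "prob_space N" and [measurable]: "g \<in> measurable N N'" "h \<in> measurable (M \<Otimes>\<^sub>M N') K"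
    and "sigma_finite_measure M"
  shows "distr (M \<Otimes>\<^sub>M distr N N' g) K h = distr (M \<Otimes>\<^sub>M N) K (\<lambda>z. h (fst z, g (snd z)))"
proof -
  interpret M: sigma_finite_measure M by fact
  interpret N: prob_space N by fact
  interpret N': prob_space "distr N N' g" by (rule N.prob_space_distr) measurable
  have "distr M M (\<lambda>x. x) \<Otimes>\<^sub>M distr N N' g = distr (M \<Otimes>\<^sub>M N) (M \<Otimes>\<^sub>M N') (\<lambda>(x, y). (x, g y))"
    by (rule pair_measure_distr) (auto intro: N'.sigma_finite_measure_axioms)
  then have "M \<Otimes>\<^sub>M distr N N' g = distr (M \<Otimes>\<^sub>M N) (M \<Otimes>\<^sub>M N') (\<lambda>(x, y). (x, g y))" by simp
  then show ?thesis by (simp add: distr_distr comp_def case_prod_beta)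
qed

lemma distr_pair_distr_left:
  assumes "prob_space M" and [measurable]: "f \<in> measurable M M'" "h \<in> measurable (M' \<Otimes>\<^sub>M N) K"
    and "prob_space N"
  shows "distr (distr M M' f \<Otimes>\<^sub>M N) K h = distr (M \<Otimes>\<^sub>M N) K (\<lambda>z. h (f (fst z), snd z))"
proof -
  interpret M: prob_space M by fact
  interpret N: prob_space N by fact
  have "distr M M' f \<Otimes>\<^sub>M distr N N (\<lambda>x. x) = distr (M \<Otimes>\<^sub>M N) (M' \<Otimes>\<^sub>M N) (\<lambda>(x, y). (f x, y))"
    by (rule pair_measure_distr) (auto intro: N.sigma_finite_measure_axioms)
  then have "distr M M' f \<Otimes>\<^sub>M N = distr (M \<Otimes>\<^sub>M N) (M' \<Otimes>\<^sub>M N) (\<lambda>(x, y). (f x, y))" by simp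
  then show ?thesis by (simp add: distr_distr comp_def case_prod_beta)
qed

lemma trunc_pos_measurable [measurable]: "trunc_pos \<in> borel_measurable borel"
  unfolding trunc_pos_def[abs_def] by measurable

lemma perpetuity_tails:
  fixes N :: "real measure" and A B :: "'a \<Rightarrow> real"
  assumes "prob_space M" "prob_space N" and sets_N [measurable_cong]: "sets N = sets borel"
    and meas [measurable]: "A \<in> borel_measurable M" "B \<in> borel_measurable M"
    and "0 < \<epsilon>0" and int0: "integrable M (\<lambda>\<omega>. \<bar>A \<omega>\<bar> powr (\<alpha> + \<epsilon>0))"
    and int: "integrable M (\<lambda>\<omega>. \<bar>A \<omega>\<bar> powr \<alpha>)" and moment: "(\<integral>\<omega>. \<bar>A \<omega>\<bar> powr \<alpha> \<partial>M) = 1"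
    and \<mu>: "\<mu> = (\<integral>\<omega>. A \<omega> powr \<alpha> * indicator {0<..} (A \<omega>) \<partial>M)" "\<mu> < 1"
    and b: "b = (\<lambda>t. \<P>(\<omega> in M. \<bar>B \<omega>\<bar> > t))" and reg: "regular_tail b \<alpha>"
    and p: "((\<lambda>t. \<P>(\<omega> in M. B \<omega> > t) / b t) \<longlongrightarrow> p) at_top"
    and q: "((\<lambda>t. \<P>(\<omega> in M. B \<omega> < - t) / b t) \<longlongrightarrow> q) at_top" and pq: "p + q = 1"
    and fixed: "N = distr (M \<Otimes>\<^sub>M N) borel (\<lambda>z. trunc_pos (A (fst z)) * snd z + B (fst z))"
  shows "((\<lambda>t. \<P>(s in N. s > t) / b t) \<longlongrightarrow> p / (1 - \<mu>)) at_top"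
    and "((\<lambda>t. \<P>(s in N. s < - t) / b t) \<longlongrightarrow> q / (1 - \<mu>)) at_top"
    and "((\<lambda>t. \<P>(z in M \<Otimes>\<^sub>M N. min (A (fst z)) 0 * snd z + B (fst z) > t) / b t) \<longlongrightarrow> 1) at_top"
    and "((\<lambda>t. \<P>(z in M \<Otimes>\<^sub>M N. min (A (fst z)) 0 * snd z + B (fst z) < - t) / b t) \<longlongrightarrow> 1) at_top"
proof -
  interpret M: prob_space M by fact
  interpret N: prob_space N by fact
  interpret R: regular_tail b \<alpha> by fact
  have \<alpha>: "0 < \<alpha>" by (rule R.\<alpha>_pos)
  have space_N: "space N = UNIV" using sets_eq_imp_space_eq[OF sets_N] by simp
  define X where "X \<omega> = trunc_pos (A \<omega>)" for \<omega>
  define Y where "Y \<omega> = - min (A \<omega>) 0" for \<omega>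
  have [measurable]: "X \<in> borel_measurable M" "Y \<in> borel_measurable M" by (simp_all add: X_def[abs_def] Y_def[abs_def])
  have XY: "0 \<le> X \<omega>" "0 \<le> Y \<omega>" "X \<omega> \<le> \<bar>A \<omega>\<bar>" "Y \<omega> \<le> \<bar>A \<omega>\<bar>" for \<omega>
    by (auto simp: X_def Y_def trunc_pos_def indicator_def)
  have powr_X: "X \<omega> powr \<alpha> = A \<omega> powr \<alpha> * indicator {0<..} (A \<omega>)" for \<omega>
    by (auto simp: X_def trunc_pos_def indicator_def)
  have powr_XY: "X \<omega> powr \<alpha> + Y \<omega> powr \<alpha> = \<bar>A \<omega>\<bar> powr \<alpha>" for \<omega>
    by (auto simp: X_def Y_def trunc_pos_def indicator_def)
  have dom: "integrable M (\<lambda>\<omega>. Z \<omega> powr e)"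
    if "integrable M (\<lambda>\<omega>. \<bar>A \<omega>\<bar> powr e)" "0 < e" "Z \<in> borel_measurable M" "\<And>\<omega>. 0 \<le> Z \<omega>" "\<And>\<omega>. Z \<omega> \<le> \<bar>A \<omega>\<bar>" for Z e
    using that by (intro Bochner_Integration.integrable_bound[OF that(1)]) (auto intro!: powr_mono2 AE_I2)
  have int_XY: "integrable M (\<lambda>\<omega>. X \<omega> powr \<alpha>)" "integrable M (\<lambda>\<omega>. Y \<omega> powr \<alpha>)"
    "integrable M (\<lambda>\<omega>. X \<omega> powr (\<alpha> + \<epsilon>0))" "integrable M (\<lambda>\<omega>. Y \<omega> powr (\<alpha> + \<epsilon>0))"
    using XY \<alpha> \<open>0 < \<epsilon>0\<close> by (auto intro!: dom int int0)
  have EX: "(\<integral>\<omega>. X \<omega> powr \<alpha> \<partial>M) = \<mu>" unfolding powr_X \<mu> ..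
  have EY: "(\<integral>\<omega>. Y \<omega> powr \<alpha> \<partial>M) = 1 - \<mu>"
    using Bochner_Integration.integral_add[OF int_XY(1,2)] unfolding powr_XY moment EX by simp
  have fixedX: "N = distr (M \<Otimes>\<^sub>M N) borel (\<lambda>z. X (fst z) * snd z + B (fst z))"
    using fixed by (simp add: X_def)
  obtain G C x0 \<epsilon> K where \<epsilon>: "\<epsilon> \<le> \<epsilon>0" and "affine_step_tail b \<alpha> M N X B G C x0 \<epsilon> K"
    using fixed_point_affine_step_tail[OF \<open>prob_space M\<close> \<open>prob_space N\<close> sets_N _ _ XY(1) _ \<open>0 < \<epsilon>0\<close> int_XY(3) _ fixedX]
      reg EX \<mu>(2) unfolding b by auto
  then interpret T: affine_step_tail b \<alpha> M N X B G C x0 \<epsilon> K by simp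
  have mX: "T.X_moment = \<mu>" unfolding T.X_moment_def by (rule EX)
  have intY: "integrable M (\<lambda>\<omega>. max_powr \<alpha> \<epsilon> (Y \<omega>))"
  proof (rule Bochner_Integration.integrable_bound)
    show "integrable M (\<lambda>\<omega>. 1 + Y \<omega> powr (\<alpha> + \<epsilon>0))" using int_XY by auto
    show "AE \<omega> in M. norm (max_powr \<alpha> \<epsilon> (Y \<omega>)) \<le> norm (1 + Y \<omega> powr (\<alpha> + \<epsilon>0))"
    proof (intro AE_I2)
      fix \<omega>
      have "max_powr \<alpha> \<epsilon> (Y \<omega>) \<le> 1 + Y \<omega> powr (\<alpha> + \<epsilon>0)" using XY \<epsilon> T.\<epsilon> by (intro max_powr_le) auto
      then show "norm (max_powr \<alpha> \<epsilon> (Y \<omega>)) \<le> norm (1 + Y \<omega> powr (\<alpha> + \<epsilon>0))"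
        by (simp add: max_powr_nonneg)
    qed
  qed measurable

  show F1: "((\<lambda>t. \<P>(s in N. s > t) / b t) \<longlongrightarrow> p / (1 - \<mu>)) at_top"
    using T.fixed_point_tail_limit[OF fixedX p] \<mu>(2) unfolding mX by simp

  define N' where "N' = distr N borel (\<lambda>s. - 1 * s)"
  have N'_tail: "\<P>(s in N'. s > t) = \<P>(s in N. s < - t)" for t
    unfolding N'_def by (subst measure_distr) (auto intro!: arg_cong[where f = "measure N"] simp: space_N)
  interpret T': affine_step_tail b \<alpha> M N' X "\<lambda>\<omega>. - 1 * B \<omega>" G C x0 \<epsilon> K
    unfolding N'_def using XY T.int_X by (intro T.reflect) auto
  have "N' = distr (distr (M \<Otimes>\<^sub>M N) borel (\<lambda>z. X (fst z) * snd z + B (fst z))) borel (\<lambda>s. - 1 * s)"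
    unfolding N'_def by (subst fixedX) simp
  also have "\<dots> = distr (M \<Otimes>\<^sub>M N) borel (\<lambda>z. X (fst z) * (- 1 * snd z) + - 1 * B (fst z))"
    by (simp add: distr_distr comp_def)
  also have "\<dots> = distr (M \<Otimes>\<^sub>M N') borel (\<lambda>z. X (fst z) * snd z + - 1 * B (fst z))"
    unfolding N'_def
    by (subst distr_pair_distr_right) (auto intro: \<open>prob_space N\<close> M.sigma_finite_measure_axioms)
  finally have fixed': "N' = distr (M \<Otimes>\<^sub>M N') borel (\<lambda>z. X (fst z) * snd z + - 1 * B (fst z))" .
  have q': "((\<lambda>t. \<P>(\<omega> in M. - 1 * B \<omega> > t) / b t) \<longlongrightarrow> q) at_top"
    using q by (simp add: less_minus_iff)
  have "T'.X_moment = \<mu>" unfolding T'.X_moment_def by (rule EX)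
  then have F2: "((\<lambda>t. \<P>(s in N'. s > t) / b t) \<longlongrightarrow> q / (1 - \<mu>)) at_top"
    using T'.fixed_point_tail_limit[OF fixed' q'] \<mu>(2) by simp
  then show "((\<lambda>t. \<P>(s in N. s < - t) / b t) \<longlongrightarrow> q / (1 - \<mu>)) at_top"
    unfolding N'_tail .

  interpret T1: affine_step_tail b \<alpha> M N' Y "\<lambda>\<omega>. 1 * B \<omega>" G C x0 \<epsilon> K
    unfolding N'_def using XY intY by (intro T.reflect) auto
  have m1: "T1.X_moment = 1 - \<mu>" unfolding T1.X_moment_def by (rule EY)
  have "((\<lambda>t. \<P>(z in M \<Otimes>\<^sub>M N'. Y (fst z) * snd z + 1 * B (fst z) > t) / b t) \<longlongrightarrow> T1.X_moment * (q / (1 - \<mu>)) + p) at_top"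
    by (intro T1.step_tail_limit F2) (use p in simp)
  moreover have "T1.X_moment * (q / (1 - \<mu>)) + p = 1" using pq \<mu>(2) by (simp add: m1)
  moreover have "\<P>(z in M \<Otimes>\<^sub>M N'. Y (fst z) * snd z + 1 * B (fst z) > t) =
      \<P>(z in M \<Otimes>\<^sub>M N. min (A (fst z)) 0 * snd z + B (fst z) > t)" for t
  proof -
    have [measurable]: "(\<lambda>z. Y (fst z) * snd z + 1 * B (fst z)) \<in> borel_measurable (M \<Otimes>\<^sub>M N')"
      "(\<lambda>z. Y (fst z) * snd z + 1 * B (fst z)) \<in> borel_measurable (M \<Otimes>\<^sub>M borel)" by measurable
    have "\<P>(z in M \<Otimes>\<^sub>M N'. Y (fst z) * snd z + 1 * B (fst z) > t) =
        measure (distr (M \<Otimes>\<^sub>M N') borel (\<lambda>z. Y (fst z) * snd z + 1 * B (fst z))) {t<..}"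
      by (subst measure_distr) (auto intro!: arg_cong[where f = "measure (M \<Otimes>\<^sub>M N')"])
    also have "\<dots> = measure (distr (M \<Otimes>\<^sub>M N) borel (\<lambda>z. Y (fst z) * (- 1 * snd z) + 1 * B (fst z))) {t<..}"
      unfolding N'_def
      by (subst distr_pair_distr_right) (auto intro: \<open>prob_space N\<close> M.sigma_finite_measure_axioms)
    also have "\<dots> = \<P>(z in M \<Otimes>\<^sub>M N. min (A (fst z)) 0 * snd z + B (fst z) > t)"
      by (subst measure_distr) (auto intro!: arg_cong[where f = "measure (M \<Otimes>\<^sub>M N)"] simp: Y_def)
    finally show ?thesis .
  qed
  ultimately show "((\<lambda>t. \<P>(z in M \<Otimes>\<^sub>M N. min (A (fst z)) 0 * snd z + B (fst z) > t) / b t) \<longlongrightarrow> 1) at_top"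
    by simp

  have N1: "distr N borel (\<lambda>s. 1 * s) = N" by (simp add: distr_id2 sets_N)
  interpret T2: affine_step_tail b \<alpha> M N Y "\<lambda>\<omega>. - 1 * B \<omega>" G C x0 \<epsilon> K
    using T.reflect[of 1 "- 1" Y] XY intY unfolding N1 by auto
  have m2: "T2.X_moment = 1 - \<mu>" unfolding T2.X_moment_def by (rule EY)
  have "((\<lambda>t. \<P>(z in M \<Otimes>\<^sub>M N. Y (fst z) * snd z + - 1 * B (fst z) > t) / b t) \<longlongrightarrow> T2.X_moment * (p / (1 - \<mu>)) + q) at_top"
    by (intro T2.step_tail_limit F1 q')
  moreover have "T2.X_moment * (p / (1 - \<mu>)) + q = 1" using pq \<mu>(2) by (simp add: m2)
  moreover have "\<P>(z in M \<Otimes>\<^sub>M N. Y (fst z) * snd z + - 1 * B (fst z) > t) =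
      \<P>(z in M \<Otimes>\<^sub>M N. min (A (fst z)) 0 * snd z + B (fst z) < - t)" for t
    by (intro arg_cong[where f = "measure (M \<Otimes>\<^sub>M N)"]) (auto simp: Y_def)
  ultimately show "((\<lambda>t. \<P>(z in M \<Otimes>\<^sub>M N. min (A (fst z)) 0 * snd z + B (fst z) < - t) / b t) \<longlongrightarrow> 1) at_top"
    by simp
qed

section \<open>The stopped perpetuity\<close>

definition perpetuity :: "(nat \<Rightarrow> real \<times> real) \<Rightarrow> real" where
  "perpetuity s = (\<Sum>k. (\<Prod>j<k. trunc_pos (fst (s j))) * snd (s k))"

lemma perpetuity_eq_sum:
  assumes "fst (s n) \<le> 0"
  shows "perpetuity s = (\<Sum>k\<le>n. (\<Prod>j<k. trunc_pos (fst (s j))) * snd (s k))"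
    and "summable (\<lambda>k. (\<Prod>j<k. trunc_pos (fst (s j))) * snd (s k))"
proof -
  have "trunc_pos (fst (s n)) = 0" using assms by (auto simp: trunc_pos_def indicator_def)
  then have zero: "(\<Prod>j<k. trunc_pos (fst (s j))) * snd (s k) = 0" if "k \<notin> {..n}" for k
    using that by auto
  show "perpetuity s = (\<Sum>k\<le>n. (\<Prod>j<k. trunc_pos (fst (s j))) * snd (s k))"
    unfolding perpetuity_def using zero by (intro suminf_finite) auto
  show "summable (\<lambda>k. (\<Prod>j<k. trunc_pos (fst (s j))) * snd (s k))"
    using zero by (intro summable_finite[of "{..n}"]) auto
qed

lemma perpetuity_case_nat:
  assumes "\<exists>n. fst (s n) \<le> 0"
  shows "perpetuity (case_nat x s) = trunc_pos (fst x) * perpetuity s + snd x"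
proof -
  define f where "f k = (\<Prod>j<k. trunc_pos (fst (s j))) * snd (s k)" for k
  define g where "g k = (\<Prod>j<k. trunc_pos (fst (case_nat x s j))) * snd (case_nat x s k)" for k
  have f: "summable f" unfolding f_def using perpetuity_eq_sum(2) assms by blast
  have g: "g (Suc k) = trunc_pos (fst x) * f k" "g 0 = snd x" for k
    by (simp_all add: f_def g_def prod.lessThan_Suc_shift del: prod.lessThan_Suc)
  have "summable g" unfolding summable_Suc_iff[of g, symmetric] g using f by (rule summable_mult)
  then have "suminf g = (\<Sum>k. trunc_pos (fst x) * f k) + snd x"
    using suminf_split_head[of g] by (simp add: g)
  also have "(\<Sum>k. trunc_pos (fst x) * f k) = trunc_pos (fst x) * suminf f" by (rule suminf_mult[OF f])
  finally show ?thesis by (simp add: perpetuity_def f_def[abs_def] g_def[abs_def])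
qed

lemma perpetuity_measurable [measurable]:
  "perpetuity \<in> borel_measurable (\<Pi>\<^sub>M i\<in>UNIV. borel \<Otimes>\<^sub>M borel)"
  unfolding perpetuity_def[abs_def] by measurable

lemma partial_product_Suc:
  "partial_product As (Suc k) \<omega> = As 1 \<omega> * (\<Prod>j<k. As (Suc (Suc j)) \<omega>)"
  unfolding partial_product_def One_nat_def prod.atLeast1_atMost_eq
  by (subst prod.lessThan_Suc_shift) simp

lemma stopped_perpetuity_eq:
  assumes "\<exists>n. As (Suc (Suc n)) \<omega> \<le> 0"
  shows "stopped_perpetuity As Bs \<omega> =
    min (As 1 \<omega>) 0 * perpetuity (\<lambda>k. (As (Suc (Suc k)) \<omega>, Bs (Suc (Suc k)) \<omega>)) + Bs 1 \<omega>"
proof -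
  have sum_eq: "perpetuity_sum As Bs (Suc n) \<omega> =
      Bs 1 \<omega> + (\<Sum>k<n. partial_product As (Suc k) \<omega> * Bs (Suc (Suc k)) \<omega>)" for n
  proof -
    have "perpetuity_sum As Bs (Suc n) \<omega> = (\<Sum>k<Suc n. partial_product As k \<omega> * Bs (Suc k) \<omega>)"
      unfolding perpetuity_sum_def by (simp add: sum.atLeast1_atMost_eq)
    also have "\<dots> = partial_product As 0 \<omega> * Bs 1 \<omega> + (\<Sum>k<n. partial_product As (Suc k) \<omega> * Bs (Suc (Suc k)) \<omega>)"
      by (subst sum.lessThan_Suc_shift) simp
    finally show ?thesis by (simp add: partial_product_def)
  qed
  show ?thesis
  proof (cases "0 \<le> As 1 \<omega>")
    case True
    then have "first_nonneg As \<omega> = 1"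
      unfolding first_nonneg_def by (intro cInf_eq_minimum) (auto simp: partial_product_def)
    then show ?thesis using True sum_eq[of 0] by (simp add: stopped_perpetuity_def)
  next
    case False
    define n where "n = (LEAST n. As (Suc (Suc n)) \<omega> \<le> 0)"
    have n: "As (Suc (Suc n)) \<omega> \<le> 0" unfolding n_def using assms by (rule LeastI_ex)
    have less: "0 < As (Suc (Suc j)) \<omega>" if "j < n" for j
      using not_less_Least[of j "\<lambda>n. As (Suc (Suc n)) \<omega> \<le> 0"] that by (auto simp: n_def)
    have prod_pos': "0 < (\<Prod>j<k. As (Suc (Suc j)) \<omega>)" if "k \<le> n" for k
      using that less by (intro prod_pos) auto
    have "first_nonneg As \<omega> = Suc (Suc n)"
      unfolding first_nonneg_def
    proof (intro cInf_eq_minimum)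
      have "0 \<le> partial_product As (Suc (Suc n)) \<omega>"
        unfolding partial_product_Suc using False n prod_pos'[of n]
        by (auto simp: zero_le_mult_iff mult_le_0_iff)
      then show "Suc (Suc n) \<in> {n. 1 \<le> n \<and> 0 \<le> partial_product As n \<omega>}" by simp
      fix k assume k: "k \<in> {n. 1 \<le> n \<and> 0 \<le> partial_product As n \<omega>}"
      show "Suc (Suc n) \<le> k"
      proof (rule ccontr)
        assume less: "\<not> Suc (Suc n) \<le> k"
        from k obtain i where i: "k = Suc i" by (cases k) auto
        then have "partial_product As k \<omega> < 0"
          unfolding i partial_product_Suc using False less prod_pos'[of i] i by (simp add: mult_less_0_iff)
        with k show False by simp
      qed
    qed
    then have "stopped_perpetuity As Bs \<omega> =
        Bs 1 \<omega> + (\<Sum>k<Suc n. partial_product As (Suc k) \<omega> * Bs (Suc (Suc k)) \<omega>)"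
      by (simp only: stopped_perpetuity_def sum_eq)
    also have "(\<Sum>k<Suc n. partial_product As (Suc k) \<omega> * Bs (Suc (Suc k)) \<omega>) =
        As 1 \<omega> * (\<Sum>k\<le>n. (\<Prod>j<k. trunc_pos (As (Suc (Suc j)) \<omega>)) * Bs (Suc (Suc k)) \<omega>)"
      unfolding sum_distrib_left
    proof (rule sum.cong)
      fix k assume "k \<in> {..n}"
      then have "(\<Prod>j<k. trunc_pos (As (Suc (Suc j)) \<omega>)) = (\<Prod>j<k. As (Suc (Suc j)) \<omega>)"
      proof (intro prod.cong refl)
        fix j assume "j \<in> {..<k}"
        with \<open>k \<in> {..n}\<close> have "0 < As (Suc (Suc j)) \<omega>" by (intro less) auto
        then show "trunc_pos (As (Suc (Suc j)) \<omega>) = As (Suc (Suc j)) \<omega>" by (simp add: trunc_pos_def)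
      qed
      then show "partial_product As (Suc k) \<omega> * Bs (Suc (Suc k)) \<omega> =
          As 1 \<omega> * ((\<Prod>j<k. trunc_pos (As (Suc (Suc j)) \<omega>)) * Bs (Suc (Suc k)) \<omega>)"
        by (simp add: partial_product_Suc)
    qed auto
    finally show ?thesis
      using perpetuity_eq_sum(1)[of "\<lambda>k. (As (Suc (Suc k)) \<omega>, Bs (Suc (Suc k)) \<omega>)" n] n False by simp
  qed
qed

lemma AE_ex_nonpos:
  assumes "prob_space \<kappa>" and sets [measurable_cong]: "sets \<kappa> = sets (borel \<Otimes>\<^sub>M borel)"
    and pos: "\<P>(x in \<kappa>. fst x > 0) < (1 :: real)"
  shows "AE s in (\<Pi>\<^sub>M i\<in>(UNIV :: nat set). \<kappa>). \<exists>n. fst (s n) \<le> (0 :: real)"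
proof -
  interpret \<kappa>: prob_space \<kappa> by fact
  interpret sequence_space \<kappa> ..
  interpret Pair: pair_prob_space \<kappa> S ..
  let ?E = "{s \<in> space S. \<forall>n. fst (s n) > 0}"
  have [measurable]: "?E \<in> sets S" by measurable
  have "measure S ?E = measure (distr (\<kappa> \<Otimes>\<^sub>M S) S (\<lambda>(s, \<omega>). case_nat s \<omega>)) ?E"
    by (simp only: PiM_iter)
  also have "\<dots> = measure (\<kappa> \<Otimes>\<^sub>M S) ((\<lambda>(s, \<omega>). case_nat s \<omega>) -` ?E \<inter> space (\<kappa> \<Otimes>\<^sub>M S))"
    by (rule measure_distr) measurable
  also have "(\<lambda>(s, \<omega>). case_nat s \<omega>) -` ?E \<inter> space (\<kappa> \<Otimes>\<^sub>M S) = {x \<in> space \<kappa>. fst x > 0} \<times> ?E"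
    by (auto simp: space_pair_measure space_PiM PiE_UNIV_domain Pi_iff split: nat.splits)
  also have "measure (\<kappa> \<Otimes>\<^sub>M S) \<dots> = \<P>(x in \<kappa>. fst x > 0) * measure S ?E"
    by (simp add: measure_def P.emeasure_pair_measure_Times enn2real_mult)
  finally have "(1 - \<P>(x in \<kappa>. fst x > 0)) * measure S ?E = 0" by (simp add: algebra_simps)
  then have "measure S ?E = 0" using pos by simp
  then have "AE s in S. s \<notin> ?E" by (intro AE_iff_measurable[THEN iffD2]) (auto simp: emeasure_eq_measure)
  then show ?thesis by (auto simp: not_less)
qed

text \<open>Both identities come from splitting off the first pair of the sequence.\<close>
lemma distr_perpetuity_fixed:
  assumes "prob_space \<kappa>" and sets [measurable_cong]: "sets \<kappa> = sets (borel \<Otimes>\<^sub>M borel)"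
    and pos: "\<P>(x in \<kappa>. fst x > 0) < (1 :: real)"
  defines "Q \<equiv> \<Pi>\<^sub>M i\<in>(UNIV :: nat set). \<kappa>"
  shows "distr Q borel perpetuity = distr (\<kappa> \<Otimes>\<^sub>M distr Q borel perpetuity) borel (\<lambda>z. trunc_pos (fst (fst z)) * snd z + snd (fst z))"
    and "distr Q borel (\<lambda>s. min (fst (s 0)) 0 * perpetuity (\<lambda>k. s (Suc k)) + snd (s 0)) =
         distr (\<kappa> \<Otimes>\<^sub>M distr Q borel perpetuity) borel (\<lambda>z. min (fst (fst z)) 0 * snd z + snd (fst z))"
proof -
  interpret \<kappa>: prob_space \<kappa> by fact
  interpret sequence_space \<kappa> ..
  interpret Pair: pair_prob_space \<kappa> S ..
  have prob_S: "prob_space S" by (rule prob_space_PiM) (rule assms(1))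
  have perp [measurable]: "perpetuity \<in> borel_measurable S"
    using perpetuity_measurable by (simp add: sets cong: measurable_cong_sets sets_PiM_cong)
  have shift: "(\<lambda>s k. s (Suc k)) \<in> measurable S S"
    by (rule measurable_PiM_single') (auto simp: space_PiM)
  have [measurable]: "(\<lambda>s. perpetuity (\<lambda>k. s (Suc k))) \<in> borel_measurable S"
    using measurable_compose[OF shift perp] .
  have "AE z in \<kappa> \<Otimes>\<^sub>M S. \<exists>n. fst (snd z n) \<le> 0"
    using AE_ex_nonpos[OF assms(1-3)] by (intro Pair.AE_pair_measure) auto
  then have ae: "AE z in \<kappa> \<Otimes>\<^sub>M S. perpetuity (case_nat (fst z) (snd z)) =
      trunc_pos (fst (fst z)) * perpetuity (snd z) + snd (fst z)"
    by eventually_elim (rule perpetuity_case_nat)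
  have "distr S borel perpetuity = distr (distr (\<kappa> \<Otimes>\<^sub>M S) S (\<lambda>(s, \<omega>). case_nat s \<omega>)) borel perpetuity"
    by (simp only: PiM_iter)
  also have "\<dots> = distr (\<kappa> \<Otimes>\<^sub>M S) borel (\<lambda>z. perpetuity (case_nat (fst z) (snd z)))"
    by (subst distr_distr) (auto simp: comp_def case_prod_beta)
  also have "\<dots> = distr (\<kappa> \<Otimes>\<^sub>M S) borel (\<lambda>z. trunc_pos (fst (fst z)) * perpetuity (snd z) + snd (fst z))"
    by (intro distr_cong_AE ae) auto
  also have "\<dots> = distr (\<kappa> \<Otimes>\<^sub>M distr S borel perpetuity) borel (\<lambda>z. trunc_pos (fst (fst z)) * snd z + snd (fst z))"
    by (subst distr_pair_distr_right) (auto intro: prob_S \<kappa>.sigma_finite_measure_axioms)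
  finally show "distr Q borel perpetuity = distr (\<kappa> \<Otimes>\<^sub>M distr Q borel perpetuity) borel (\<lambda>z. trunc_pos (fst (fst z)) * snd z + snd (fst z))"
    unfolding Q_def .
  have "distr S borel (\<lambda>s. min (fst (s 0)) 0 * perpetuity (\<lambda>k. s (Suc k)) + snd (s 0)) =
      distr (distr (\<kappa> \<Otimes>\<^sub>M S) S (\<lambda>(s, \<omega>). case_nat s \<omega>)) borel (\<lambda>s. min (fst (s 0)) 0 * perpetuity (\<lambda>k. s (Suc k)) + snd (s 0))"
    by (simp only: PiM_iter)
  also have "\<dots> = distr (\<kappa> \<Otimes>\<^sub>M S) borel (\<lambda>z. min (fst (fst z)) 0 * perpetuity (snd z) + snd (fst z))"
    by (subst distr_distr) (auto simp: comp_def case_prod_beta)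
  also have "\<dots> = distr (\<kappa> \<Otimes>\<^sub>M distr S borel perpetuity) borel (\<lambda>z. min (fst (fst z)) 0 * snd z + snd (fst z))"
    by (subst distr_pair_distr_right) (auto intro: prob_S \<kappa>.sigma_finite_measure_axioms)
  finally show "distr Q borel (\<lambda>s. min (fst (s 0)) 0 * perpetuity (\<lambda>k. s (Suc k)) + snd (s 0)) =
         distr (\<kappa> \<Otimes>\<^sub>M distr Q borel perpetuity) borel (\<lambda>z. min (fst (fst z)) 0 * snd z + snd (fst z))"
    unfolding Q_def .
qed

lemma (in prob_space) distr_shifted_sequence:
  fixes Z :: "nat \<Rightarrow> 'a \<Rightarrow> 'b"
  assumes indep: "indep_vars (\<lambda>_. K) Z {1..}"
    and law: "\<And>n. n \<ge> 1 \<Longrightarrow> distr M K (Z n) = \<kappa>"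
  shows "distr M (\<Pi>\<^sub>M i\<in>UNIV. \<kappa>) (\<lambda>\<omega> k. Z (Suc k) \<omega>) = (\<Pi>\<^sub>M i\<in>UNIV. \<kappa>)"
proof -
  have rv: "Z i \<in> measurable M K" if "i \<in> {1..}" for i
    using indep that unfolding indep_vars_def by blast
  have sets: "sets \<kappa> = sets K" using law[of 1] by (metis order_refl sets_distr)
  have rv': "Z i \<in> measurable M \<kappa>" if "i \<in> {1..}" for i
    using rv[OF that] sets by (simp cong: measurable_cong_sets)
  have \<kappa>: "prob_space \<kappa>" using prob_space_distr[OF rv[of 1]] law[of 1] by simp
  have "distr M (\<Pi>\<^sub>M i\<in>{1..}. K) (\<lambda>\<omega>. \<lambda>i\<in>{1..}. Z i \<omega>) = (\<Pi>\<^sub>M i\<in>{1..}. distr M K (Z i))"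
    using indep rv by (subst (asm) indep_vars_iff_distr_eq_PiM') auto
  also have "\<dots> = (\<Pi>\<^sub>M i\<in>{1..}. \<kappa>)" using law by (intro PiM_cong) auto
  also have "distr M (\<Pi>\<^sub>M i\<in>{1..}. K) (\<lambda>\<omega>. \<lambda>i\<in>{1..}. Z i \<omega>) = distr M (\<Pi>\<^sub>M i\<in>{1..}. \<kappa>) (\<lambda>\<omega>. \<lambda>i\<in>{1..}. Z i \<omega>)"
    using sets by (intro distr_cong sets_PiM_cong) auto
  finally have joint: "distr M (\<Pi>\<^sub>M i\<in>{1..}. \<kappa>) (\<lambda>\<omega>. \<lambda>i\<in>{1..}. Z i \<omega>) = (\<Pi>\<^sub>M i\<in>{1..}. \<kappa>)" .
  have "distr (\<Pi>\<^sub>M i\<in>{1..}. \<kappa>) (\<Pi>\<^sub>M i\<in>UNIV. \<kappa>) (\<lambda>s. \<lambda>n\<in>UNIV. s (Suc n)) = (\<Pi>\<^sub>M i\<in>UNIV. \<kappa>)"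
    by (rule distr_PiM_reindex) (auto intro: \<kappa>)
  then have "(\<Pi>\<^sub>M i\<in>UNIV. \<kappa>) = distr (distr M (\<Pi>\<^sub>M i\<in>{1..}. \<kappa>) (\<lambda>\<omega>. \<lambda>i\<in>{1..}. Z i \<omega>)) (\<Pi>\<^sub>M i\<in>UNIV. \<kappa>) (\<lambda>s. \<lambda>n\<in>UNIV. s (Suc n))"
    unfolding joint by simp
  also have "\<dots> = distr M (\<Pi>\<^sub>M i\<in>UNIV. \<kappa>) ((\<lambda>s. \<lambda>n\<in>UNIV. s (Suc n)) \<circ> (\<lambda>\<omega>. \<lambda>i\<in>{1..}. Z i \<omega>))"
    using rv' by (intro distr_distr) (auto intro!: measurable_restrict measurable_component_singleton)
  also have "(\<lambda>s. \<lambda>n\<in>UNIV. s (Suc n)) \<circ> (\<lambda>\<omega>. \<lambda>i\<in>{1..}. Z i \<omega>) = (\<lambda>\<omega> k. Z (Suc k) \<omega>)"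
    by (auto simp: fun_eq_iff)
  finally show ?thesis by simp
qed

lemma distr_affine_indep_pair:
  fixes S :: "'a \<Rightarrow> real" and A B :: "'a \<Rightarrow> real"
  assumes "prob_space M" and indep: "indep_pair M borel S (borel \<Otimes>\<^sub>M borel) (\<lambda>\<omega>. (A \<omega>, B \<omega>))"
  shows "distr M borel (\<lambda>\<omega>. A \<omega> * S \<omega> + B \<omega>) =
    distr (M \<Otimes>\<^sub>M distr M borel S) borel (\<lambda>z. A (fst z) * snd z + B (fst z))"
proof -
  interpret prob_space M by fact
  define Y where "Y \<omega> = (A \<omega>, B \<omega>)" for \<omega>
  have S [measurable]: "S \<in> borel_measurable M" and Y [measurable]: "Y \<in> measurable M (borel \<Otimes>\<^sub>M borel)"
    using indep by (auto simp: indep_pair_def Y_def[abs_def])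
  have [measurable]: "A \<in> borel_measurable M" "B \<in> borel_measurable M"
    using measurable_compose[OF Y measurable_fst] measurable_compose[OF Y measurable_snd] by (simp_all add: Y_def)
  have prod: "prob ((S -` U \<inter> space M) \<inter> (Y -` V \<inter> space M)) = prob (S -` U \<inter> space M) * prob (Y -` V \<inter> space M)"
    if "U \<in> sets borel" "V \<in> sets (borel \<Otimes>\<^sub>M borel)" for U V
  proof (rule indep_setD)
    show "indep_set {S -` U \<inter> space M |U. U \<in> sets borel} {Y -` V \<inter> space M |V. V \<in> sets (borel \<Otimes>\<^sub>M borel)}"
      using indep by (simp add: indep_pair_def Y_def[abs_def])
  qed (use that in auto)
  interpret NS: prob_space "distr M borel S" by (rule prob_space_distr) measurable
  interpret NY: prob_space "distr M (borel \<Otimes>\<^sub>M borel) Y" by (rule prob_space_distr) measurable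
  have joint: "distr M (borel \<Otimes>\<^sub>M borel) Y \<Otimes>\<^sub>M distr M borel S =
      distr M ((borel \<Otimes>\<^sub>M borel) \<Otimes>\<^sub>M borel) (\<lambda>\<omega>. (Y \<omega>, S \<omega>))"
  proof (rule pair_measure_eqI)
    fix V :: "(real \<times> real) set" and U :: "real set"
    assume "V \<in> sets (distr M (borel \<Otimes>\<^sub>M borel) Y)" "U \<in> sets (distr M borel S)"
    then have UV [measurable]: "V \<in> sets (borel \<Otimes>\<^sub>M borel)" "U \<in> sets borel" by auto
    have "(\<lambda>\<omega>. (Y \<omega>, S \<omega>)) -` (V \<times> U) \<inter> space M = (S -` U \<inter> space M) \<inter> (Y -` V \<inter> space M)" by auto
    then show "emeasure (distr M (borel \<Otimes>\<^sub>M borel) Y) V * emeasure (distr M borel S) U =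
        emeasure (distr M ((borel \<Otimes>\<^sub>M borel) \<Otimes>\<^sub>M borel) (\<lambda>\<omega>. (Y \<omega>, S \<omega>))) (V \<times> U)"
      using prod[OF UV(2,1)]
      by (simp add: emeasure_distr emeasure_eq_measure ennreal_mult' [symmetric] mult.commute)
  qed (auto intro: NS.sigma_finite_measure_axioms NY.sigma_finite_measure_axioms sets_pair_measure_cong)
  let ?h = "\<lambda>z :: (real \<times> real) \<times> real. fst (fst z) * snd z + snd (fst z)"
  have "distr M borel (\<lambda>\<omega>. A \<omega> * S \<omega> + B \<omega>) =
      distr (distr M ((borel \<Otimes>\<^sub>M borel) \<Otimes>\<^sub>M borel) (\<lambda>\<omega>. (Y \<omega>, S \<omega>))) borel ?h"
    by (subst distr_distr) (auto simp: comp_def Y_def)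
  also have "\<dots> = distr (M \<Otimes>\<^sub>M distr M borel S) borel (\<lambda>z. A (fst z) * snd z + B (fst z))"
    unfolding joint[symmetric]
    by (subst distr_pair_distr_left) (auto intro: assms(1) NS.prob_space_axioms simp: Y_def)
  finally show ?thesis .
qed

lemma first_nonneg_measurable:
  assumes "\<And>n. n \<ge> 1 \<Longrightarrow> As n \<in> borel_measurable M"
  shows "first_nonneg As \<in> measurable M (count_space UNIV)"
proof -
  have [measurable]: "partial_product As n \<in> borel_measurable M" for n
    unfolding partial_product_def[abs_def] using assms by (intro borel_measurable_prod) auto
  show ?thesis unfolding first_nonneg_def[abs_def] Inf_nat_def by measurable
qed

lemma stopped_perpetuity_measurable:
  assumes As: "\<And>n. n \<ge> 1 \<Longrightarrow> As n \<in> borel_measurable M" and Bs: "\<And>n. n \<ge> 1 \<Longrightarrow> Bs n \<in> borel_measurable M"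
  shows "stopped_perpetuity As Bs \<in> borel_measurable M"
proof -
  have pp [measurable]: "partial_product As n \<in> borel_measurable M" for n
    unfolding partial_product_def[abs_def] using As by (intro borel_measurable_prod) auto
  have "perpetuity_sum As Bs n \<in> borel_measurable M" for n
    unfolding perpetuity_sum_def[abs_def] using Bs by (intro borel_measurable_sum borel_measurable_times pp) auto
  then show ?thesis
    unfolding stopped_perpetuity_def[abs_def]
    by (rule measurable_compose_countable) (rule first_nonneg_measurable[OF As])
qed

theorem theorem5p4:
  fixes M :: "'a measure" and A B S :: "'a \<Rightarrow> real"
    and As Bs :: "nat \<Rightarrow> 'a \<Rightarrow> real"
    and L :: "real \<Rightarrow> real" and \<alpha> p q \<mu> :: real
  assumes "prob_space M"
    and "A \<in> borel_measurable M" and "B \<in> borel_measurable M"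
    and "\<alpha> > 0"
    and "\<P>(\<omega> in M. A \<omega> < 0) > 0" and "\<P>(\<omega> in M. A \<omega> > 0) > 0"
    and "ext_expectation M (\<lambda>\<omega>. log_abs (A \<omega>)) < 0"
    and "integrable M (\<lambda>\<omega>. \<bar>A \<omega>\<bar> powr \<alpha>)"
    and "(\<integral>\<omega>. \<bar>A \<omega>\<bar> powr \<alpha> \<partial>M) = 1"
    and "slowly_varying L"
    and "p \<ge> 0" and "q \<ge> 0" and "p + q = 1"
    and "asymp_mult (\<lambda>t. \<P>(\<omega> in M. B \<omega> > t)) p (\<lambda>t. t powr (-\<alpha>) * L t)"
    and "asymp_mult (\<lambda>t. \<P>(\<omega> in M. B \<omega> < - t)) q (\<lambda>t. t powr (-\<alpha>) * L t)"
    and "\<exists>\<epsilon>>0. integrable M (\<lambda>\<omega>. \<bar>A \<omega>\<bar> powr (\<alpha> + \<epsilon>))"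
    and "\<mu> = (\<integral>\<omega>. A \<omega> powr \<alpha> * indicator {0<..} (A \<omega>) \<partial>M)"
    and "\<mu> < 1"
    \<comment> \<open>\<open>S\<close> solves \<open>S = A\<^sub>+ S + B\<close> in distribution, with \<open>S\<close> and \<open>(A\<^sub>+, B)\<close> independent\<close>
    and "S \<in> borel_measurable M"
    and "indep_pair M borel S (borel \<Otimes>\<^sub>M borel) (\<lambda>\<omega>. (trunc_pos (A \<omega>), B \<omega>))"
    and "distr M borel S = distr M borel (\<lambda>\<omega>. trunc_pos (A \<omega>) * S \<omega> + B \<omega>)"
    \<comment> \<open>the pairs \<open>(As n, Bs n)\<close>, \<open>n \<ge> 1\<close>, are i.i.d. copies of \<open>(A, B)\<close>\<close>
    and "prob_space.indep_vars M (\<lambda>_. borel \<Otimes>\<^sub>M borel) (\<lambda>n \<omega>. (As n \<omega>, Bs n \<omega>)) {1..}"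
    and "\<And>n. n \<ge> 1 \<Longrightarrow>
           distr M (borel \<Otimes>\<^sub>M borel) (\<lambda>\<omega>. (As n \<omega>, Bs n \<omega>)) =
           distr M (borel \<Otimes>\<^sub>M borel) (\<lambda>\<omega>. (A \<omega>, B \<omega>))"
  shows "(if p = 0
            then (\<lambda>t. \<P>(\<omega> in M. S \<omega> > t)) \<in> o(\<lambda>t. t powr (-\<alpha>) * L t)
            else (\<lambda>t. \<P>(\<omega> in M. S \<omega> > t)) \<sim>[at_top]
                   (\<lambda>t. 1 / (1 - \<mu>) * \<P>(\<omega> in M. B \<omega> > t))) \<and>
         (if q = 0
            then (\<lambda>t. \<P>(\<omega> in M. S \<omega> < - t)) \<in> o(\<lambda>t. t powr (-\<alpha>) * L t)
            else (\<lambda>t. \<P>(\<omega> in M. S \<omega> < - t)) \<sim>[at_top]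
                   (\<lambda>t. 1 / (1 - \<mu>) * \<P>(\<omega> in M. B \<omega> < - t))) \<and>
         (\<lambda>t. \<P>(\<omega> in M. stopped_perpetuity As Bs \<omega> > t)) \<sim>[at_top]
           (\<lambda>t. \<P>(\<omega> in M. \<bar>B \<omega>\<bar> > t)) \<and>
         (\<lambda>t. \<P>(\<omega> in M. \<bar>B \<omega>\<bar> > t)) \<sim>[at_top]
           (\<lambda>t. \<P>(\<omega> in M. stopped_perpetuity As Bs \<omega> < - t))"
proof -
  interpret prob_space M by fact
  note [measurable] = assms(2,3,19)
  obtain \<epsilon>0 where \<epsilon>0: "0 < \<epsilon>0" "integrable M (\<lambda>\<omega>. \<bar>A \<omega>\<bar> powr (\<alpha> + \<epsilon>0))" using assms(16) by blast
  define b where "b = (\<lambda>t. \<P>(\<omega> in M. \<bar>B \<omega>\<bar> > t))"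
  have reg: "regular_tail b \<alpha>"
    and p: "((\<lambda>t. \<P>(\<omega> in M. B \<omega> > t) / b t) \<longlongrightarrow> p) at_top"
    and q: "((\<lambda>t. \<P>(\<omega> in M. B \<omega> < - t) / b t) \<longlongrightarrow> q) at_top"
    and bg: "((\<lambda>t. b t / (t powr (- \<alpha>) * L t)) \<longlongrightarrow> 1) at_top"
    unfolding b_def using tail_regular[OF assms(3,4,10,13,14,15)] by auto
  interpret regular_tail b \<alpha> by fact
  note tails = perpetuity_tails[OF assms(1) _ _ assms(2,3) \<epsilon>0 assms(8,9,17,18) b_def reg p q assms(13)]

  define N where "N = distr M borel S"
  interpret N: prob_space N unfolding N_def by (rule prob_space_distr) measurable
  have N_gt: "\<P>(s in N. s > t) = \<P>(\<omega> in M. S \<omega> > t)" and N_lt: "\<P>(s in N. s < - t) = \<P>(\<omega> in M. S \<omega> < - t)" for t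
    unfolding N_def by (subst measure_distr; auto intro!: arg_cong[where f = prob])+
  have N_fixed: "N = distr (M \<Otimes>\<^sub>M N) borel (\<lambda>z. trunc_pos (A (fst z)) * snd z + B (fst z))"
    unfolding N_def using assms(21) distr_affine_indep_pair[OF assms(1,20)] by simp
  have S_tails: "((\<lambda>t. \<P>(\<omega> in M. S \<omega> > t) / b t) \<longlongrightarrow> p / (1 - \<mu>)) at_top"
    "((\<lambda>t. \<P>(\<omega> in M. S \<omega> < - t) / b t) \<longlongrightarrow> q / (1 - \<mu>)) at_top"
    using tails(1,2)[OF N.prob_space_axioms _ N_fixed] unfolding N_gt N_lt by (auto simp: N_def)

  define \<kappa> where "\<kappa> = distr M (borel \<Otimes>\<^sub>M borel) (\<lambda>\<omega>. (A \<omega>, B \<omega>))"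
  have sets_\<kappa> [measurable_cong]: "sets \<kappa> = sets (borel \<Otimes>\<^sub>M borel)" by (simp add: \<kappa>_def)
  interpret \<kappa>: prob_space \<kappa> unfolding \<kappa>_def by (rule prob_space_distr) measurable
  define Q where "Q = (\<Pi>\<^sub>M i\<in>(UNIV :: nat set). \<kappa>)"
  interpret Q: prob_space Q unfolding Q_def by (rule prob_space_PiM) (rule \<kappa>.prob_space_axioms)
  have "Measurable.pred (borel \<Otimes>\<^sub>M borel) (\<lambda>x :: real \<times> real. fst x > 0)" by measurable
  then have "{x :: real \<times> real. fst x > 0} \<in> sets (borel \<Otimes>\<^sub>M borel)" by (simp add: pred_def space_pair_measure)
  then have "\<P>(x in \<kappa>. fst x > 0) = \<P>(\<omega> in M. A \<omega> > 0)"
    unfolding \<kappa>_def by (subst measure_distr) (auto intro!: arg_cong[where f = prob] simp: space_pair_measure)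
  also have "\<P>(\<omega> in M. A \<omega> > 0) + \<P>(\<omega> in M. A \<omega> < 0) \<le> 1"
    by (subst finite_measure_Union[symmetric]) auto
  then have "\<P>(\<omega> in M. A \<omega> > 0) < 1" using assms(5) by linarith
  finally have \<kappa>_pos: "\<P>(x in \<kappa>. fst x > 0) < 1" .
  have perp [measurable]: "perpetuity \<in> borel_measurable Q"
    using perpetuity_measurable by (simp add: Q_def sets_\<kappa> cong: measurable_cong_sets sets_PiM_cong)
  define N' where "N' = distr Q borel perpetuity"
  interpret N': prob_space N' unfolding N'_def by (rule Q.prob_space_distr) measurable
  have sets_N' [measurable_cong]: "sets N' = sets borel" by (simp add: N'_def)
  have N'_fixed: "N' = distr (M \<Otimes>\<^sub>M N') borel (\<lambda>z. trunc_pos (A (fst z)) * snd z + B (fst z))"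
  proof -
    have "N' = distr (\<kappa> \<Otimes>\<^sub>M N') borel (\<lambda>z. trunc_pos (fst (fst z)) * snd z + snd (fst z))"
      unfolding N'_def Q_def by (rule distr_perpetuity_fixed(1)[OF \<kappa>.prob_space_axioms sets_\<kappa> \<kappa>_pos])
    also have "\<dots> = distr (M \<Otimes>\<^sub>M N') borel (\<lambda>z. trunc_pos (A (fst z)) * snd z + B (fst z))"
      unfolding \<kappa>_def by (subst distr_pair_distr_left) (auto intro: assms(1) N'.prob_space_axioms)
    finally show ?thesis .
  qed

  let ?R = "stopped_perpetuity As Bs"
  define Z where "Z n \<omega> = (As n \<omega>, Bs n \<omega>)" for n \<omega>
  have Z [measurable]: "Z n \<in> measurable M (borel \<Otimes>\<^sub>M borel)" if "n \<ge> 1" for n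
    using assms(22) that unfolding indep_vars_def Z_def[abs_def] by auto
  have AsBs: "As n \<in> borel_measurable M" "Bs n \<in> borel_measurable M" if "n \<ge> 1" for n
    using measurable_compose[OF Z[OF that] measurable_fst] measurable_compose[OF Z[OF that] measurable_snd]
    by (simp_all add: Z_def)
  have R_meas [measurable]: "?R \<in> borel_measurable M" by (rule stopped_perpetuity_measurable) (auto intro: AsBs)
  have Z_law: "distr M Q (\<lambda>\<omega> k. Z (Suc k) \<omega>) = Q"
    unfolding Q_def
  proof (rule distr_shifted_sequence)
    show "indep_vars (\<lambda>_. borel \<Otimes>\<^sub>M borel) Z {1..}" using assms(22) by (simp add: Z_def[abs_def])
    show "distr M (borel \<Otimes>\<^sub>M borel) (Z n) = \<kappa>" if "n \<ge> 1" for n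
      using assms(23)[OF that] by (simp add: Z_def[abs_def] \<kappa>_def)
  qed
  have Z_meas [measurable]: "(\<lambda>\<omega> k. Z (Suc k) \<omega>) \<in> measurable M Q"
    unfolding Q_def
  proof (rule measurable_PiM_single')
    show "(\<lambda>\<omega>. Z (Suc i) \<omega>) \<in> measurable M \<kappa>" for i using Z[of "Suc i"] by (simp add: sets_\<kappa> cong: measurable_cong_sets)
    then show "(\<lambda>\<omega> i. Z (Suc i) \<omega>) \<in> space M \<rightarrow> (\<Pi>\<^sub>E i\<in>UNIV. space \<kappa>)" by (auto simp: sets_eq_imp_space_eq[OF sets_\<kappa>] space_pair_measure)
  qed
  have shift [measurable]: "(\<lambda>s k. s (Suc k)) \<in> measurable Q Q"
    unfolding Q_def by (rule measurable_PiM_single') (auto simp: space_PiM)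
  have perp_shift [measurable]: "(\<lambda>s. perpetuity (\<lambda>k. s (Suc k))) \<in> borel_measurable Q"
    using measurable_compose[OF shift perp] .
  let ?h = "\<lambda>s :: nat \<Rightarrow> real \<times> real. min (fst (s 0)) 0 * perpetuity (\<lambda>k. s (Suc k)) + snd (s 0)"
  have comp [measurable]: "(\<lambda>s. s n) \<in> measurable Q (borel \<Otimes>\<^sub>M borel)" for n
    unfolding Q_def using measurable_component_singleton[of n UNIV "\<lambda>_. \<kappa>"] sets_\<kappa> by (simp cong: measurable_cong_sets)
  have h_meas: "?h \<in> borel_measurable Q" by measurable
  have "AE s in distr Q Q (\<lambda>s k. s (Suc k)). \<exists>n. fst (s n) \<le> 0"
  proof -
    have eq: "distr Q Q (\<lambda>s k. s (Suc k)) = Q"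
    proof -
      have "(\<lambda>s :: nat \<Rightarrow> real \<times> real. \<lambda>n\<in>UNIV. s (Suc n)) = (\<lambda>s k. s (Suc k))" by (auto simp: fun_eq_iff)
      then show ?thesis
        using distr_PiM_reindex[of UNIV "\<lambda>_. \<kappa>" Suc UNIV] \<kappa>.prob_space_axioms unfolding Q_def by simp
    qed
    show ?thesis
      unfolding eq unfolding Q_def by (rule AE_ex_nonpos[OF \<kappa>.prob_space_axioms sets_\<kappa> \<kappa>_pos])
  qed
  then have "AE s in Q. \<exists>n. fst (s (Suc n)) \<le> 0" by (subst (asm) AE_distr_iff) auto
  then have "AE s in distr M Q (\<lambda>\<omega> k. Z (Suc k) \<omega>). \<exists>n. fst (s (Suc n)) \<le> 0" unfolding Z_law .
  then have "AE \<omega> in M. \<exists>n. fst (Z (Suc (Suc n)) \<omega>) \<le> 0" by (subst (asm) AE_distr_iff) auto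
  then have R_eq: "AE \<omega> in M. ?R \<omega> = ?h (\<lambda>k. Z (Suc k) \<omega>)"
    by eventually_elim (simp add: Z_def stopped_perpetuity_eq)
  have "distr M borel ?R = distr M borel (\<lambda>\<omega>. ?h (\<lambda>k. Z (Suc k) \<omega>))"
    by (intro distr_cong_AE R_eq refl R_meas measurable_compose[OF Z_meas h_meas])
  also have "\<dots> = distr (distr M Q (\<lambda>\<omega> k. Z (Suc k) \<omega>)) borel ?h"
    using distr_distr[OF h_meas Z_meas] by (simp add: comp_def)
  also have "\<dots> = distr Q borel ?h" unfolding Z_law ..
  also have "\<dots> = distr (\<kappa> \<Otimes>\<^sub>M N') borel (\<lambda>z. min (fst (fst z)) 0 * snd z + snd (fst z))"
    unfolding N'_def Q_def by (rule distr_perpetuity_fixed(2)[OF \<kappa>.prob_space_axioms sets_\<kappa> \<kappa>_pos])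
  also have "\<dots> = distr (M \<Otimes>\<^sub>M N') borel (\<lambda>z. min (A (fst z)) 0 * snd z + B (fst z))"
    unfolding \<kappa>_def by (subst distr_pair_distr_left) (auto intro: assms(1) N'.prob_space_axioms)
  finally have R_law: "distr M borel ?R = distr (M \<Otimes>\<^sub>M N') borel (\<lambda>z. min (A (fst z)) 0 * snd z + B (fst z))" .
  have R_prob: "\<P>(\<omega> in M. ?R \<omega> \<in> U) = \<P>(z in M \<Otimes>\<^sub>M N'. min (A (fst z)) 0 * snd z + B (fst z) \<in> U)"
    if [measurable]: "U \<in> sets borel" for U
  proof -
    have "\<P>(\<omega> in M. ?R \<omega> \<in> U) = measure (distr M borel ?R) U"
      by (subst measure_distr) (auto intro!: arg_cong[where f = prob])
    also have "\<dots> = \<P>(z in M \<Otimes>\<^sub>M N'. min (A (fst z)) 0 * snd z + B (fst z) \<in> U)"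
      unfolding R_law by (subst measure_distr) (auto intro!: arg_cong[where f = "measure _"])
    finally show ?thesis .
  qed
  have R_tails: "((\<lambda>t. \<P>(\<omega> in M. ?R \<omega> > t) / b t) \<longlongrightarrow> 1) at_top"
    "((\<lambda>t. \<P>(\<omega> in M. ?R \<omega> < - t) / b t) \<longlongrightarrow> 1) at_top"
    using tails(3,4)[OF N'.prob_space_axioms sets_N' N'_fixed]
      R_prob[of "{_<..}"] R_prob[of "{..<_}"] by simp_all

  have b_nonzero: "b t \<noteq> 0" for t using b_pos[of t] by simp
  have small: "f \<in> o(\<lambda>t. t powr (- \<alpha>) * L t)" if "((\<lambda>t. f t / b t) \<longlongrightarrow> 0) at_top" for f
  proof (rule smalloI_tendsto)
    have "((\<lambda>t. (f t / b t) * (b t / (t powr (- \<alpha>) * L t))) \<longlongrightarrow> 0 * 1) at_top" by (intro tendsto_mult that bg)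
    then show "((\<lambda>t. f t / (t powr (- \<alpha>) * L t)) \<longlongrightarrow> 0) at_top" using b_nonzero by simp
    show "eventually (\<lambda>t. t powr (- \<alpha>) * L t \<noteq> 0) at_top"
      using eventually_gt_at_top[of 0] by eventually_elim (use assms(10) in \<open>force simp: slowly_varying_def\<close>)
  qed
  have equiv: "f \<sim>[at_top] (\<lambda>t. 1 / (1 - \<mu>) * g t)"
    if f: "((\<lambda>t. f t / b t) \<longlongrightarrow> c / (1 - \<mu>)) at_top" and g: "((\<lambda>t. g t / b t) \<longlongrightarrow> c) at_top" and "c \<noteq> 0" for f g c
  proof (rule asymp_equivI'_const)
    have "((\<lambda>t. (f t / b t) / (g t / b t)) \<longlongrightarrow> (c / (1 - \<mu>)) / c) at_top" by (rule tendsto_divide[OF f g \<open>c \<noteq> 0\<close>])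
    then show "((\<lambda>t. f t / g t) \<longlongrightarrow> 1 / (1 - \<mu>)) at_top" using b_nonzero \<open>c \<noteq> 0\<close> by simp
  qed (use assms(18) in simp)
  have R1: "(\<lambda>t. \<P>(\<omega> in M. ?R \<omega> > t)) \<sim>[at_top] b" "b \<sim>[at_top] (\<lambda>t. \<P>(\<omega> in M. ?R \<omega> < - t))"
    using R_tails by (auto intro: asymp_equivI' asymp_equiv_symI)
  have S0: "(\<lambda>t. \<P>(\<omega> in M. S \<omega> > t)) \<in> o(\<lambda>t. t powr (- \<alpha>) * L t)" if "p = 0"
    using S_tails(1) that by (intro small) simp
  have S0': "(\<lambda>t. \<P>(\<omega> in M. S \<omega> < - t)) \<in> o(\<lambda>t. t powr (- \<alpha>) * L t)" if "q = 0"
    using S_tails(2) that by (intro small) simp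
  show ?thesis
    using S0 S0' equiv[OF S_tails(1) p] equiv[OF S_tails(2) q] R1 by (simp add: b_def)
qed

end
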